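(* Let $r\ge1$. Every embedding of the randomized one-out-of-two oblivious transfer of $r$-bit strings $P^{\mathrm{OT}^r}_{X,Y}$ has leakage at least $1-O(r2^{-r})$ (i.e. there is a constant $C$ such that for all $r$ the leakage is at least $1-Cr2^{-r}$).
   Context: $P^{\mathrm{OT}^r}_{X,Y}$ is the distribution with Alice's output $X=(x_0,x_1)\in(\{0,1\}^r)^2$ and Bob's output $Y=(c,y)$, $c\in\{0,1\}$, $y\in\{0,1\}^r$, with $P((x_0,x_1),(c,y))=2^{-2r-1}$ if $y=x_c$ and $0$ otherwise. For a primitive $P_{X,Y}$ on finite sets $\mathcal X\times\mathcal Y$: $\mathcal H_A,\mathcal H_B$ have computational bases indexed by $\mathcal X,\mathcal Y$; $\mathcal H_{A'},\mathcal H_{B'}$ are finite-dimensional (possibly trivial) work spaces; for a pure state on $AA'BB'$, $X$ (resp. $Y$) is the outcome of measuring $A$ (resp. $B$) in the computational basis; entropic quantities are evaluated on the state obtained by measuring exactly the registers named by $X$ or $Y$ and tracing out unmentioned registers; $S(P;Q)=S(P)+S(Q)-S(PQ)$ (von Neumann); $I$ is Shannon mutual information. An embedding of $P_{X,Y}$ is a pure state with $(X,Y)\sim P_{X,Y}$ and $S(X;YB')=S(XA';Y)=I(X;Y)$; its leakage is $\Delta_\psi(P_{X,Y})=\max\{S(X;BB')-I(X;Y),S(AA';Y)-I(X;Y)\}$. *)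

theory Defs
  imports Complex_Main "Jordan_Normal_Form.Char_Poly"
begin

definition eta :: "real \<Rightarrow> real" where
  "eta x = (if x \<le> 0 then 0 else - x * log 2 x)"

definition vn_entropy :: "complex mat \<Rightarrow> real" where
  "vn_entropy A = (\<Sum>z\<in>{z. poly (char_poly A) z = 0}.
                      real (order z (char_poly A)) * eta (Re z))"

text \<open>Registers: 0 = A, 1 = A', 2 = B, 3 = B'. A pure state is given by its amplitudes
  \<open>psi a a' b b'\<close> with \<open>a < d 0\<close>, \<open>a' < d 1\<close>, \<open>b < d 2\<close>, \<open>b' < d 3\<close>.
  Global basis indices \<open>i < d 0 * d 1 * d 2 * d 3\<close> are decoded in mixed radix.\<close>

definition dimtot :: "(nat \<Rightarrow> nat) \<Rightarrow> nat" where
  "dimtot d = d 0 * d 1 * d 2 * d 3"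

definition comp :: "(nat \<Rightarrow> nat) \<Rightarrow> nat \<Rightarrow> nat \<Rightarrow> nat" where
  "comp d i j =
     (if j = 3 then i mod d 3
      else if j = 2 then (i div d 3) mod d 2
      else if j = 1 then (i div (d 3 * d 2)) mod d 1
      else i div (d 3 * d 2 * d 1))"

definition amp :: "(nat \<Rightarrow> nat \<Rightarrow> nat \<Rightarrow> nat \<Rightarrow> complex) \<Rightarrow> (nat \<Rightarrow> nat) \<Rightarrow> nat \<Rightarrow> complex" where
  "amp psi d i = psi (comp d i 0) (comp d i 1) (comp d i 2) (comp d i 3)"

text \<open>What happens to each register: kept as a quantum register, measured in the
  computational basis, or traced out.\<close>
datatype regmode = Qu | Meas | Tr

text \<open>Reduced (post-measurement) state. Traced-out registers are replaced by the fixed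
  basis state 0 (tensoring with a pure state does not change the entropy), so that
  the state is a matrix of the full dimension.\<close>
definition reduced ::
  "(nat \<Rightarrow> nat \<Rightarrow> nat \<Rightarrow> nat \<Rightarrow> complex) \<Rightarrow> (nat \<Rightarrow> nat) \<Rightarrow> (nat \<Rightarrow> regmode) \<Rightarrow> complex mat" where
  "reduced psi d md = mat (dimtot d) (dimtot d) (\<lambda>(i, k).
     if (\<forall>j<4. md j = Tr \<longrightarrow> comp d i j = 0 \<and> comp d k j = 0)
      \<and> (\<forall>j<4. md j = Meas \<longrightarrow> comp d i j = comp d k j)
     then (\<Sum>(m, m') \<in> {(m, m'). m < dimtot d \<and> m' < dimtot d
              \<and> (\<forall>j<4. md j = Tr \<longrightarrow> comp d m j = comp d m' j)
              \<and> (\<forall>j<4. md j \<noteq> Tr \<longrightarrow> comp d m j = comp d i j \<and> comp d m' j = comp d k j)}.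
            amp psi d m * cnj (amp psi d m'))
     else 0)"

definition ent :: "(nat \<Rightarrow> nat \<Rightarrow> nat \<Rightarrow> nat \<Rightarrow> complex) \<Rightarrow> (nat \<Rightarrow> nat) \<Rightarrow> (nat \<Rightarrow> regmode) \<Rightarrow> real" where
  "ent psi d md = vn_entropy (reduced psi d md)"

definition modes :: "nat set \<Rightarrow> nat set \<Rightarrow> nat \<Rightarrow> regmode" where
  "modes Ms Qs j = (if j \<in> Ms then Meas else if j \<in> Qs then Qu else Tr)"

definition qmi ::
  "(nat \<Rightarrow> nat \<Rightarrow> nat \<Rightarrow> nat \<Rightarrow> complex) \<Rightarrow> (nat \<Rightarrow> nat) \<Rightarrow> nat set \<Rightarrow> nat set \<Rightarrow> nat set \<Rightarrow> nat set \<Rightarrow> real" where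
  "qmi psi d M1 Q1 M2 Q2 =
     ent psi d (modes M1 Q1) + ent psi d (modes M2 Q2) - ent psi d (modes (M1 \<union> M2) (Q1 \<union> Q2))"

definition shannon :: "nat set \<Rightarrow> (nat \<Rightarrow> real) \<Rightarrow> real" where
  "shannon S p = (\<Sum>s\<in>S. eta (p s))"

definition shannon_mi :: "nat \<Rightarrow> nat \<Rightarrow> (nat \<Rightarrow> nat \<Rightarrow> real) \<Rightarrow> real" where
  "shannon_mi nx ny P =
     shannon {..<nx} (\<lambda>x. \<Sum>y<ny. P x y) + shannon {..<ny} (\<lambda>y. \<Sum>x<nx. P x y)
     - shannon {..<nx * ny} (\<lambda>z. P (z div ny) (z mod ny))"

text \<open>Randomized OT of r-bit strings. r-bit strings are encoded as naturals below 2^r.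
  Alice's output (x0, x1) is encoded as x0 + 2^r * x1 (< 2^(2r)); Bob's output (c, y)
  as c + 2 * y (< 2^(r+1)).\<close>
definition P_OT :: "nat \<Rightarrow> nat \<Rightarrow> nat \<Rightarrow> real" where
  "P_OT r x yy =
     (if x < 2^(2*r) \<and> yy < 2^(r+1) \<and>
         yy div 2 = (if yy mod 2 = 0 then x mod 2^r else x div 2^r)
      then 1 / 2^(2*r+1) else 0)"

definition nX :: "nat \<Rightarrow> nat" where "nX r = 2^(2*r)"
definition nY :: "nat \<Rightarrow> nat" where "nY r = 2^(r+1)"

text \<open>Register numbering: A = 0, A' = 1, B = 2, B' = 3. d is the dimension vector with
  d 0 = |X|, d 2 = |Y|, d 1, d 3 positive (work spaces, possibly trivial).\<close>
definition is_embedding ::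
  "nat \<Rightarrow> nat \<Rightarrow> (nat \<Rightarrow> nat \<Rightarrow> real) \<Rightarrow> (nat \<Rightarrow> nat) \<Rightarrow> (nat \<Rightarrow> nat \<Rightarrow> nat \<Rightarrow> nat \<Rightarrow> complex) \<Rightarrow> bool" where
  "is_embedding nx ny P d psi \<longleftrightarrow>
     d 0 = nx \<and> d 2 = ny \<and> 0 < d 1 \<and> 0 < d 3 \<and>
     (\<forall>x<nx. \<forall>y<ny. (\<Sum>a'<d 1. \<Sum>b'<d 3. (cmod (psi x a' y b'))\<^sup>2) = P x y) \<and>
     qmi psi d {0} {} {2} {3} = shannon_mi nx ny P \<and>
     qmi psi d {0} {1} {2} {} = shannon_mi nx ny P"

definition leakage ::
  "nat \<Rightarrow> nat \<Rightarrow> (nat \<Rightarrow> nat \<Rightarrow> real) \<Rightarrow> (nat \<Rightarrow> nat) \<Rightarrow> (nat \<Rightarrow> nat \<Rightarrow> nat \<Rightarrow> nat \<Rightarrow> complex) \<Rightarrow> real" where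
  "leakage nx ny P d psi =
     max (qmi psi d {0} {} {} {2, 3} - shannon_mi nx ny P)
         (qmi psi d {} {0, 1} {2} {} - shannon_mi nx ny P)"

end

theory Submission
  imports Defs "HOL-Computational_Algebra.Fundamental_Theorem_Algebra"
begin

text \<open>Write \<open>N = 2^r\<close>. Both embedding conditions are equality cases of Klein's inequality: the state
  of \<open>B'\<close> given \<open>(x, y)\<close> depends on \<open>y\<close> only, and that of \<open>A'\<close> on \<open>x\<close> only. Let \<open>\<sigma>\<close> be the reduced
  state \<open>\<rho>\<close> of \<open>BB'\<close> with the blocks off the diagonal in \<open>B\<close> deleted, which is the state of \<open>YB'\<close>. Expanding in
  eigenbases of both and using \<open>ln t \<le> t - 1\<close> gives
  \<open>S(\<rho>) \<ge> S(\<sigma>) - (tr (\<rho>\<^sup>2 \<sigma>\<inverse>) - 1) / ln 2\<close>. An off-diagonal block \<open>(y, y')\<close> is nonzero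
  only if \<open>y\<close> and \<open>y'\<close> have a common, then unique, compatible \<open>x\<close>, and independence makes the total
  contribution of these blocks to the trace equal to \<open>1 / N\<close>; hence \<open>S(BB') \<ge> S(YB') - 1 / (N ln 2)\<close>.
  By purity \<open>S(XBB') = S(XA')\<close> and \<open>S(XYB') = S(XYA')\<close>, so the two embedding conditions turn this into
  \<open>S(X;BB') - I(X;Y) \<ge> H(Y|X) - 1 / (N ln 2) = 1 - 1 / (N ln 2)\<close>.\<close>

section \<open>Hermitian kernels on finite sets\<close>

text \<open>The obstacle is that \<rho> and \<sigma> need not commute. Operator logarithms are
  avoided: every trace becomes a double sum over two eigenbases weighted by squared overlaps, so one
  scalar inequality serves twice. At \<open>t = s / lam\<close> it bounds an entropy from above,
  with a rigid equality case; at \<open>t = lam / s\<close> it bounds an entropy from below, at the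
  price of a second moment. The factor \<open>ln 2\<close> is the change to base 2. The equality
  cases are available because the conditional distributions are uniform: given \<open>y\<close>
  there are exactly \<open>N\<close> compatible \<open>x\<close>, given \<open>x\<close> exactly two
  \<open>y\<close>, and the embedding conditions push the entropy of \<open>X\<close> given
  \<open>YB'\<close> to its maximum \<open>log 2 N\<close> and that of \<open>Y\<close> given
  \<open>XA'\<close> to its maximum 1. The value \<open>1 / N\<close> arises as follows. On an
  eigenvector of the block \<open>y\<close> with eigenvalue \<open>s\<close>, each of the
  \<open>N\<close> compatible \<open>x\<close> contributes a vector of squared norm
  \<open>s^2 / N^2\<close>, which lands in the block of the one other \<open>y'\<close> compatible
  with that \<open>x\<close>. This adds up to \<open>s^2 / N\<close>; dividing by \<open>s\<close>
  and summing the eigenvalues leaves \<open>1 / N\<close>. The resulting error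
  \<open>1 / (N ln 2)\<close> is better than the required order by a factor
  \<open>r\<close>.\<close>

definition ip :: "'a set \<Rightarrow> ('a \<Rightarrow> complex) \<Rightarrow> ('a \<Rightarrow> complex) \<Rightarrow> complex" where
  "ip S u v = (\<Sum>i\<in>S. cnj (u i) * v i)"

definition nsq :: "'a set \<Rightarrow> ('a \<Rightarrow> complex) \<Rightarrow> real" where
  "nsq S u = (\<Sum>i\<in>S. (cmod (u i))\<^sup>2)"

definition ap :: "'a set \<Rightarrow> ('a \<Rightarrow> 'a \<Rightarrow> complex) \<Rightarrow> ('a \<Rightarrow> complex) \<Rightarrow> 'a \<Rightarrow> complex" where
  "ap S G u i = (\<Sum>j\<in>S. G i j * u j)"

text \<open>The family is indexed by \<open>S\<close> itself, hence a square matrix. Orthonormality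
  and completeness are its two one-sided inverse laws; carrying both replaces a dimension
  argument.\<close>

definition onb :: "'a set \<Rightarrow> ('a \<Rightarrow> 'a \<Rightarrow> complex) \<Rightarrow> bool" where
  "onb S f \<longleftrightarrow> (\<forall>k\<in>S. \<forall>l\<in>S. ip S (f k) (f l) = of_bool (k = l)) \<and>
     (\<forall>i\<in>S. \<forall>j\<in>S. (\<Sum>k\<in>S. f k i * cnj (f k j)) = of_bool (i = j))"

definition eigenbasis :: "'a set \<Rightarrow> ('a \<Rightarrow> 'a \<Rightarrow> complex) \<Rightarrow> ('a \<Rightarrow> 'a \<Rightarrow> complex) \<Rightarrow> ('a \<Rightarrow> real) \<Rightarrow> bool" where
  "eigenbasis S G f s \<longleftrightarrow> onb S f \<and>
     (\<forall>i\<in>S. \<forall>j\<in>S. G i j = (\<Sum>k\<in>S. of_real (s k) * f k i * cnj (f k j)))"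

definition herm :: "'a set \<Rightarrow> ('a \<Rightarrow> 'a \<Rightarrow> complex) \<Rightarrow> bool" where
  "herm S G \<longleftrightarrow> (\<forall>i\<in>S. \<forall>j\<in>S. G j i = cnj (G i j))"

definition psd :: "'a set \<Rightarrow> ('a \<Rightarrow> 'a \<Rightarrow> complex) \<Rightarrow> bool" where
  "psd S G \<longleftrightarrow> herm S G \<and> (\<forall>u. 0 \<le> Re (ip S u (ap S G u)))"

lemma onbD:
  assumes "onb S f"
  shows "k \<in> S \<Longrightarrow> l \<in> S \<Longrightarrow> ip S (f k) (f l) = of_bool (k = l)"
    and "i \<in> S \<Longrightarrow> j \<in> S \<Longrightarrow> (\<Sum>k\<in>S. f k i * cnj (f k j)) = of_bool (i = j)"
  using assms by (auto simp: onb_def)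

lemma eigenbasisD:
  assumes "eigenbasis S G f s"
  shows "onb S f" and "i \<in> S \<Longrightarrow> j \<in> S \<Longrightarrow> G i j = (\<Sum>k\<in>S. of_real (s k) * f k i * cnj (f k j))"
  using assms by (auto simp: eigenbasis_def)

lemma ip_cong:
  "(\<And>i. i \<in> S \<Longrightarrow> u i = u' i) \<Longrightarrow> (\<And>i. i \<in> S \<Longrightarrow> v i = v' i) \<Longrightarrow> ip S u v = ip S u' v'"
  unfolding ip_def by (intro sum.cong) auto

lemma nsq_cong: "(\<And>i. i \<in> S \<Longrightarrow> u i = v i) \<Longrightarrow> nsq S u = nsq S v"
  unfolding nsq_def by (intro sum.cong) auto

lemma cnj_ip: "cnj (ip S u v) = ip S v u"
  by (simp add: ip_def cnj_sum mult.commute)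

lemma ip_scale_right: "ip S u (\<lambda>i. c * v i) = c * ip S u v"
  by (simp add: ip_def sum_distrib_left algebra_simps)

lemma ip_scale_left: "ip S (\<lambda>i. c * u i) v = cnj c * ip S u v"
  by (simp add: ip_def sum_distrib_left algebra_simps)

lemma ip_self: "ip S u u = of_real (nsq S u)"
  unfolding ip_def nsq_def of_real_sum
  by (intro sum.cong refl) (metis complex_norm_square mult.commute of_real_power)

lemma nsq_nonneg [simp]: "0 \<le> nsq S u"
  by (simp add: nsq_def sum_nonneg)

lemma nsq_scale: "nsq S (\<lambda>i. c * u i) = (cmod c)\<^sup>2 * nsq S u"
  by (simp add: nsq_def norm_mult power_mult_distrib sum_distrib_left)

lemma nsq_0_iff: "finite S \<Longrightarrow> nsq S u = 0 \<longleftrightarrow> (\<forall>i\<in>S. u i = 0)"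
  by (simp add: nsq_def sum_nonneg_eq_0_iff)

lemma ip_sum_right: "ip S u (\<lambda>i. \<Sum>k\<in>K. c k * w k i) = (\<Sum>k\<in>K. c k * ip S u (w k))"
proof -
  have "ip S u (\<lambda>i. \<Sum>k\<in>K. c k * w k i) = (\<Sum>i\<in>S. \<Sum>k\<in>K. c k * (cnj (u i) * w k i))"
    by (simp add: ip_def sum_distrib_left algebra_simps)
  also have "\<dots> = (\<Sum>k\<in>K. c k * ip S u (w k))"
    by (subst sum.swap) (simp add: ip_def sum_distrib_left)
  finally show ?thesis .
qed

lemma ip_sum_left: "ip S (\<lambda>i. \<Sum>k\<in>K. c k * w k i) u = (\<Sum>k\<in>K. cnj (c k) * ip S (w k) u)"
  using arg_cong[OF ip_sum_right[of S u c w K], of cnj] by (simp add: cnj_ip)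

lemma sum_of_bool_left:
  assumes "finite S" "a \<in> S"
  shows "(\<Sum>k\<in>S. g k * of_bool (k = a)) = (g a :: complex)"
    and "(\<Sum>k\<in>S. g k * of_bool (a = k)) = (g a :: complex)"
    and "(\<Sum>k\<in>S. of_bool (k = a) * g k) = (g a :: complex)"
    and "(\<Sum>k\<in>S. of_bool (a = k) * g k) = (g a :: complex)"
  using assms by (simp_all add: of_bool_def if_distrib if_distribR cong: if_cong)

lemma onb_expand:
  assumes "finite S" "onb S f" "i \<in> S"
  shows "u i = (\<Sum>k\<in>S. ip S (f k) u * f k i)"
proof -
  have "(\<Sum>k\<in>S. ip S (f k) u * f k i) = (\<Sum>k\<in>S. \<Sum>j\<in>S. u j * (f k i * cnj (f k j)))"
    by (simp add: ip_def sum_distrib_right sum_distrib_left algebra_simps)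
  also have "\<dots> = (\<Sum>j\<in>S. u j * (\<Sum>k\<in>S. f k i * cnj (f k j)))"
    by (subst sum.swap) (simp add: sum_distrib_left)
  also have "\<dots> = (\<Sum>j\<in>S. u j * of_bool (i = j))"
    using onbD(2)[OF assms(2)] assms(3) by (intro sum.cong) auto
  also have "\<dots> = u i" using assms by (simp add: sum_of_bool_left)
  finally show ?thesis ..
qed

lemma parseval:
  assumes "finite S" "onb S f"
  shows "ip S u v = (\<Sum>k\<in>S. ip S u (f k) * ip S (f k) v)"
proof -
  have "ip S u v = ip S u (\<lambda>i. \<Sum>k\<in>S. ip S (f k) v * f k i)"
    using onb_expand[OF assms] by (intro ip_cong) auto
  also have "\<dots> = (\<Sum>k\<in>S. ip S u (f k) * ip S (f k) v)"
    unfolding ip_sum_right by (intro sum.cong refl mult.commute)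
  finally show ?thesis .
qed

lemma ip_mult_swap: "ip S u v * ip S v u = of_real ((cmod (ip S u v))\<^sup>2)"
  by (metis cnj_ip complex_norm_square of_real_power)

lemma cmod_ip_commute: "cmod (ip S u v) = cmod (ip S v u)"
  by (metis cnj_ip complex_mod_cnj)

lemma parseval_nsq:
  assumes "finite S" "onb S f"
  shows "nsq S u = (\<Sum>k\<in>S. (cmod (ip S (f k) u))\<^sup>2)"
proof -
  have "complex_of_real (nsq S u) = of_real (\<Sum>k\<in>S. (cmod (ip S (f k) u))\<^sup>2)"
    unfolding ip_self[symmetric] of_real_sum
    by (subst parseval[OF assms]) (simp add: ip_mult_swap cmod_ip_commute[of S u])
  then show ?thesis by (simp only: of_real_eq_iff)
qed

lemma onb_nsq: "onb S f \<Longrightarrow> k \<in> S \<Longrightarrow> nsq S (f k) = 1"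
  using onbD(1)[of S f k k] by (simp add: ip_self)

lemma eigenbasis_ap:
  assumes "eigenbasis S G f s" "i \<in> S"
  shows "ap S G u i = (\<Sum>k\<in>S. (of_real (s k) * ip S (f k) u) * f k i)"
proof -
  have "ap S G u i = (\<Sum>j\<in>S. \<Sum>k\<in>S. of_real (s k) * f k i * (cnj (f k j) * u j))"
    unfolding ap_def using eigenbasisD(2)[OF assms(1)] assms(2)
    by (intro sum.cong refl) (simp add: sum_distrib_left sum_distrib_right algebra_simps)
  also have "\<dots> = (\<Sum>k\<in>S. (of_real (s k) * ip S (f k) u) * f k i)"
    by (subst sum.swap) (simp add: ip_def sum_distrib_left sum_distrib_right algebra_simps)
  finally show ?thesis .
qed

lemma eigenbasis_eigenvector:
  assumes "finite S" "eigenbasis S G f s" "i \<in> S" "k \<in> S"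
  shows "ap S G (f k) i = of_real (s k) * f k i"
proof -
  have "ap S G (f k) i = (\<Sum>l\<in>S. of_bool (l = k) * (of_real (s l) * f l i))"
    unfolding eigenbasis_ap[OF assms(2,3)]
    using onbD(1)[OF eigenbasisD(1)[OF assms(2)]] assms(4) by (intro sum.cong) auto
  then show ?thesis using assms by (simp add: sum_of_bool_left)
qed

lemma eigenbasis_ip:
  assumes "finite S" "eigenbasis S G f s" "k \<in> S"
  shows "ip S (f k) (ap S G u) = of_real (s k) * ip S (f k) u"
proof -
  have "ip S (f k) (ap S G u) = ip S (f k) (\<lambda>i. \<Sum>k\<in>S. (of_real (s k) * ip S (f k) u) * f k i)"
    by (rule ip_cong) (auto simp: eigenbasis_ap[OF assms(2)])
  also have "\<dots> = (\<Sum>l\<in>S. of_bool (k = l) * (of_real (s l) * ip S (f l) u))"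
    unfolding ip_sum_right
    using onbD(1)[OF eigenbasisD(1)[OF assms(2)]] assms(3) by (intro sum.cong) auto
  finally show ?thesis using assms by (simp add: sum_of_bool_left)
qed

lemma eigenbasis_quadratic:
  assumes "finite S" "eigenbasis S G f s"
  shows "Re (ip S u (ap S G u)) = (\<Sum>k\<in>S. s k * (cmod (ip S (f k) u))\<^sup>2)"
proof -
  have "ip S u (ap S G u) = (\<Sum>k\<in>S. ip S u (f k) * ip S (f k) (ap S G u))"
    by (rule parseval[OF assms(1) eigenbasisD(1)[OF assms(2)]])
  also have "\<dots> = (\<Sum>k\<in>S. of_real (s k) * (ip S u (f k) * ip S (f k) u))"
    by (intro sum.cong) (simp_all add: eigenbasis_ip[OF assms])
  also have "\<dots> = of_real (\<Sum>k\<in>S. s k * (cmod (ip S (f k) u))\<^sup>2)"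
    by (simp add: ip_mult_swap cmod_ip_commute[of S u])
  finally show ?thesis by simp
qed

lemma eigenbasis_nsq_ap:
  assumes "finite S" "eigenbasis S G f s"
  shows "nsq S (ap S G u) = (\<Sum>k\<in>S. (s k)\<^sup>2 * (cmod (ip S (f k) u))\<^sup>2)"
  unfolding parseval_nsq[OF assms(1) eigenbasisD(1)[OF assms(2)], of "ap S G u"]
  by (intro sum.cong) (simp_all add: eigenbasis_ip[OF assms] norm_mult power_mult_distrib)

lemma eigenbasis_psd_nonneg:
  assumes "finite S" "eigenbasis S G f s" "psd S G" "k \<in> S"
  shows "0 \<le> s k"
proof -
  have "ip S (f k) (ap S G (f k)) = of_real (s k)"
    using assms onbD(1)[OF eigenbasisD(1)[OF assms(2)], of k k] by (simp add: eigenbasis_ip)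
  then show ?thesis using assms(3) unfolding psd_def by (metis Re_complex_of_real)
qed

lemma gram_ap:
  assumes "\<And>i j. i \<in> S \<Longrightarrow> j \<in> S \<Longrightarrow> G i j = (\<Sum>k\<in>K. v k i * cnj (v k j))" "i \<in> S"
  shows "ap S G u i = (\<Sum>k\<in>K. ip S (v k) u * v k i)"
proof -
  have "ap S G u i = (\<Sum>j\<in>S. \<Sum>k\<in>K. v k i * (cnj (v k j) * u j))"
    unfolding ap_def using assms
    by (intro sum.cong refl) (simp add: sum_distrib_left sum_distrib_right algebra_simps)
  also have "\<dots> = (\<Sum>k\<in>K. ip S (v k) u * v k i)"
    by (subst sum.swap) (simp add: ip_def sum_distrib_left sum_distrib_right algebra_simps)
  finally show ?thesis .
qed

lemma psd_gram:
  assumes "\<And>i j. i \<in> S \<Longrightarrow> j \<in> S \<Longrightarrow> G i j = (\<Sum>k\<in>K. v k i * cnj (v k j))"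
  shows "psd S G"
proof -
  have "0 \<le> Re (ip S u (ap S G u))" for u
  proof -
    have "ip S u (ap S G u) = ip S u (\<lambda>i. \<Sum>k\<in>K. ip S (v k) u * v k i)"
      using gram_ap[OF assms] by (intro ip_cong) auto
    also have "\<dots> = of_real (\<Sum>k\<in>K. (cmod (ip S (v k) u))\<^sup>2)"
      by (simp add: ip_sum_right ip_mult_swap)
    finally show ?thesis by (simp add: sum_nonneg)
  qed
  moreover have "herm S G"
    using assms by (simp add: herm_def cnj_sum algebra_simps)
  ultimately show ?thesis by (simp add: psd_def)
qed

section \<open>The spectral theorem for Hermitian kernels\<close>

lemma exists_eigenvector:
  assumes "finite S" "S \<noteq> {}"
  shows "\<exists>v c. (\<exists>i\<in>S. v i \<noteq> 0) \<and> (\<forall>i\<in>S. ap S G v i = c * v i)"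
proof -
  define n where "n = card S"
  obtain h where h: "bij_betw h {..<n} S"
    using ex_bij_betw_nat_finite[OF assms(1)] by (auto simp: n_def atLeast0LessThan)
  define A where "A = mat n n (\<lambda>(i,j). G (h i) (h j))"
  have A: "A \<in> carrier_mat n n" by (simp add: A_def)
  have "degree (char_poly A) = n" using degree_monic_char_poly[OF A] by simp
  moreover have "n \<noteq> 0" using assms by (simp add: n_def)
  ultimately have "\<not> constant (poly (char_poly A))" by (simp add: constant_degree)
  then obtain c where "poly (char_poly A) c = 0"
    using fundamental_theorem_of_algebra by blast
  then have "eigenvalue A c" using eigenvalue_root_char_poly[OF A] by simp
  then obtain w where w: "w \<in> carrier_vec n" "w \<noteq> 0\<^sub>v n" "A *\<^sub>v w = c \<cdot>\<^sub>v w"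
    using A unfolding eigenvalue_def eigenvector_def by auto
  define g where "g = the_inv_into {..<n} h"
  have g: "g (h i) = i" if "i < n" for i
    using h that unfolding g_def bij_betw_def by (simp add: the_inv_into_f_f)
  define v where "v = (\<lambda>i. w $ g i)"
  have "\<exists>i<n. w $ i \<noteq> 0"
  proof (rule ccontr)
    assume "\<not> ?thesis"
    then have "w = 0\<^sub>v n" using w(1) by (intro eq_vecI) auto
    then show False using w(2) by simp
  qed
  then obtain i where i: "i < n" "w $ i \<noteq> 0" by blast
  have "v (h i) \<noteq> 0" "h i \<in> S" using i g h by (auto simp: v_def bij_betw_def)
  moreover have "ap S G v x = c * v x" if "x \<in> S" for x
  proof -
    have "x \<in> h ` {..<n}" using h that by (simp add: bij_betw_def)
    then obtain i where i: "i < n" "x = h i" by auto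
    have "ap S G v x = (\<Sum>j<n. G x (h j) * v (h j))"
      unfolding ap_def by (rule sum.reindex_bij_betw[OF h, symmetric])
    also have "\<dots> = (A *\<^sub>v w) $ i"
      using i w(1) by (auto simp: A_def v_def g scalar_prod_def atLeast0LessThan intro!: sum.cong)
    also have "\<dots> = c * v x" using i w(1,3) by (simp add: v_def g)
    finally show ?thesis .
  qed
  ultimately show ?thesis by blast
qed

text \<open>Change of basis by \<open>h\<close>: the weight \<open>w = 1\<close> yields completeness
  of the new family, the eigenvalues as \<open>w\<close> yield the spectral decomposition.\<close>

lemma transport_sum:
  "(\<Sum>k\<in>S. w k * (\<Sum>a\<in>S. g k a * h a i) * cnj (\<Sum>b\<in>S. g k b * h b j)) =
   (\<Sum>a\<in>S. \<Sum>b\<in>S. (\<Sum>k\<in>S. w k * g k a * cnj (g k b)) * (h a i * cnj (h b j)))"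
proof -
  have "(\<Sum>k\<in>S. w k * (\<Sum>a\<in>S. g k a * h a i) * cnj (\<Sum>b\<in>S. g k b * h b j)) =
    (\<Sum>k\<in>S. \<Sum>a\<in>S. \<Sum>b\<in>S. w k * g k a * cnj (g k b) * (h a i * cnj (h b j)))"
    by (simp add: cnj_sum sum_distrib_left sum_distrib_right algebra_simps)
  also have "\<dots> = (\<Sum>a\<in>S. \<Sum>k\<in>S. \<Sum>b\<in>S. w k * g k a * cnj (g k b) * (h a i * cnj (h b j)))"
    by (rule sum.swap)
  also have "\<dots> = (\<Sum>a\<in>S. \<Sum>b\<in>S. \<Sum>k\<in>S. w k * g k a * cnj (g k b) * (h a i * cnj (h b j)))"
    by (intro sum.cong refl sum.swap)
  finally show ?thesis by (simp add: sum_distrib_right)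
qed

lemma onb_transport:
  assumes "finite S" "onb S h" "onb S g"
  shows "onb S (\<lambda>k i. \<Sum>a\<in>S. g k a * h a i)"
proof -
  have "ip S (\<lambda>i. \<Sum>a\<in>S. g k a * h a i) (\<lambda>i. \<Sum>a\<in>S. g l a * h a i) = of_bool (k = l)"
    if "k \<in> S" "l \<in> S" for k l
  proof -
    have "ip S (\<lambda>i. \<Sum>a\<in>S. g k a * h a i) (\<lambda>i. \<Sum>a\<in>S. g l a * h a i) =
      (\<Sum>a\<in>S. cnj (g k a) * (\<Sum>b\<in>S. g l b * of_bool (a = b)))"
      unfolding ip_sum_left unfolding ip_sum_right
      using onbD(1)[OF assms(2)] by (intro sum.cong refl arg_cong2[of _ _ _ _ "(*)"]) auto
    also have "\<dots> = ip S (g k) (g l)"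
      using assms(1) by (simp add: ip_def sum_of_bool_left)
    finally show ?thesis using onbD(1)[OF assms(3)] that by simp
  qed
  moreover have "(\<Sum>k\<in>S. (\<Sum>a\<in>S. g k a * h a i) * cnj (\<Sum>a\<in>S. g k a * h a j)) = of_bool (i = j)"
    if "i \<in> S" "j \<in> S" for i j
  proof -
    have "(\<Sum>k\<in>S. (\<Sum>a\<in>S. g k a * h a i) * cnj (\<Sum>a\<in>S. g k a * h a j)) =
      (\<Sum>a\<in>S. \<Sum>b\<in>S. (\<Sum>k\<in>S. g k a * cnj (g k b)) * (h a i * cnj (h b j)))"
      using transport_sum[where w="\<lambda>_. 1"] by simp
    also have "\<dots> = (\<Sum>a\<in>S. \<Sum>b\<in>S. of_bool (a = b) * (h a i * cnj (h b j)))"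
      using onbD(2)[OF assms(3)] by (intro sum.cong) auto
    also have "\<dots> = (\<Sum>a\<in>S. h a i * cnj (h a j))"
      using assms(1) by (simp add: sum_of_bool_left)
    finally show ?thesis using onbD(2)[OF assms(2)] that by simp
  qed
  ultimately show ?thesis by (simp add: onb_def)
qed

lemma eigenbasis_transport:
  assumes "finite S" "onb S h" "eigenbasis S (\<lambda>a b. ip S (h a) (ap S A (h b))) g s"
  shows "eigenbasis S A (\<lambda>k i. \<Sum>a\<in>S. g k a * h a i) s"
proof -
  have "A i j = (\<Sum>k\<in>S. of_real (s k) * (\<Sum>a\<in>S. g k a * h a i) * cnj (\<Sum>a\<in>S. g k a * h a j))"
    if i: "i \<in> S" and j: "j \<in> S" for i j
  proof -
    have col: "(\<Sum>b\<in>S. ip S (h a) (ap S A (h b)) * cnj (h b j)) = ip S (h a) (\<lambda>i. A i j)" for a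
    proof -
      have "(\<Sum>b\<in>S. ip S (h a) (ap S A (h b)) * cnj (h b j)) =
        ip S (h a) (\<lambda>i. \<Sum>b\<in>S. cnj (h b j) * ap S A (h b) i)"
        by (simp only: ip_sum_right mult.commute)
      also have "\<dots> = ip S (h a) (\<lambda>i. A i j)"
      proof (rule ip_cong)
        fix i
        have "(\<Sum>b\<in>S. cnj (h b j) * ap S A (h b) i) = (\<Sum>b\<in>S. \<Sum>m\<in>S. A i m * (h b m * cnj (h b j)))"
          by (simp add: ap_def sum_distrib_left sum_distrib_right algebra_simps)
        also have "\<dots> = (\<Sum>m\<in>S. A i m * (\<Sum>b\<in>S. h b m * cnj (h b j)))"
          by (subst sum.swap) (simp add: sum_distrib_left)
        also have "\<dots> = (\<Sum>m\<in>S. A i m * of_bool (m = j))"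
          using onbD(2)[OF assms(2)] j by (intro sum.cong) auto
        finally show "(\<Sum>b\<in>S. cnj (h b j) * ap S A (h b) i) = A i j"
          using assms(1) j by (simp add: sum_of_bool_left)
      qed simp
      finally show ?thesis .
    qed
    have "(\<Sum>k\<in>S. of_real (s k) * (\<Sum>a\<in>S. g k a * h a i) * cnj (\<Sum>a\<in>S. g k a * h a j)) =
      (\<Sum>a\<in>S. \<Sum>b\<in>S. ip S (h a) (ap S A (h b)) * (h a i * cnj (h b j)))"
      unfolding transport_sum[where h=h and i=i and j=j]
      by (intro sum.cong refl arg_cong2[of _ _ _ _ "(*)"] eigenbasisD(2)[OF assms(3), symmetric])
    also have "\<dots> = (\<Sum>a\<in>S. (\<Sum>b\<in>S. ip S (h a) (ap S A (h b)) * cnj (h b j)) * h a i)"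
      unfolding sum_distrib_right by (intro sum.cong refl) (simp only: ac_simps)
    also have "\<dots> = A i j"
      unfolding col by (rule onb_expand[OF assms(1,2) i, symmetric])
    finally show ?thesis ..
  qed
  then show ?thesis using onb_transport[OF assms(1,2) eigenbasisD(1)[OF assms(3)]] by (simp add: eigenbasis_def)
qed

text \<open>The vectors \<open>h k\<close> are the columns of the Householder reflection that exchanges \<open>v\<close>
  with the basis vector at \<open>s0\<close>; if these agree, then \<open>c = 2 / 0 = 0\<close> makes it the identity.\<close>
lemma onb_extending:
  assumes fin: "finite S" and s0: "s0 \<in> S" and v: "nsq S v = 1" and im: "Im (v s0) = 0"
  obtains h where "onb S h" "\<And>i. i \<in> S \<Longrightarrow> h s0 i = v i"
proof -
  define u where "u = (\<lambda>i. v i - of_bool (i = s0))"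
  define c where "c = 2 / nsq S u"
  define h where "h = (\<lambda>k i. of_bool (i = k) - of_real c * (u i * cnj (u k)))"
  define al where "al = Re (v s0)"
  \<comment> \<open>Exchanging two unit vectors by a reflection needs a real inner product between
    them; this is where \<open>im\<close> enters.\<close>
  have vs0: "v s0 = of_real al" using im by (simp add: al_def complex_eq_iff)
  have nu: "nsq S u = 2 - 2 * al"
  proof -
    have "(cmod (u i))\<^sup>2 = (cmod (v i))\<^sup>2 + of_bool (i = s0) * (1 - 2 * al)" for i
    proof (cases "i = s0")
      case True
      then have "u i = of_real (al - 1)" "v i = of_real al" by (simp_all add: u_def vs0)
      then show ?thesis using True
        by (simp only: norm_of_real power2_abs) (simp add: power2_eq_square algebra_simps)
    qed (simp add: u_def)
    then have "nsq S u = nsq S v + (\<Sum>i\<in>S. of_bool (i = s0) * (1 - 2 * al))"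
      by (simp add: nsq_def sum.distrib)
    also have "(\<Sum>i\<in>S. of_bool (i = s0) * (1 - 2 * al)) = 1 - 2 * al"
      using fin s0 by (simp add: of_bool_def if_distrib if_distribR cong: if_cong)
    finally show ?thesis using v by simp
  qed
  have c2: "c * (c * nsq S u) = 2 * c" by (simp add: c_def)
  have uip: "(\<Sum>i\<in>S. u i * cnj (u i)) = of_real (nsq S u)"
    using ip_self[of S u] by (simp add: ip_def mult.commute)
  have "(\<Sum>i\<in>S. cnj (h k i) * h l i) = of_bool (k = l)" if "k \<in> S" "l \<in> S" for k l
  proof -
    have "(\<Sum>i\<in>S. cnj (h k i) * h l i) = (\<Sum>i\<in>S. of_bool (i = k) * of_bool (i = l)
       - of_real c * (of_bool (i = k) * (u i * cnj (u l))) - of_real c * (of_bool (i = l) * (cnj (u i) * u k))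
       + of_real c * of_real c * (u k * cnj (u l)) * (u i * cnj (u i)))"
      by (intro sum.cong refl) (simp add: h_def algebra_simps)
    also have "\<dots> = of_bool (k = l) - of_real c * (u k * cnj (u l)) - of_real c * (cnj (u l) * u k)
        + of_real c * of_real c * (u k * cnj (u l)) * of_real (nsq S u)"
      unfolding sum.distrib sum_subtractf sum_distrib_left[symmetric] uip
      using fin that by (simp add: sum_of_bool_left)
    also have "\<dots> = of_bool (k = l) + (u k * cnj (u l)) * of_real (c * (c * nsq S u) - 2 * c)"
      by (simp add: algebra_simps)
    finally show ?thesis by (simp add: c2)
  qed
  moreover have "cnj (h k i) = h i k" for i k by (auto simp: h_def)
  ultimately have 1: "\<And>k l. k \<in> S \<Longrightarrow> l \<in> S \<Longrightarrow> (\<Sum>i\<in>S. h i k * h l i) = of_bool (k = l)"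
    and herm: "\<And>k i. cnj (h k i) = h i k"
    by auto
  have "onb S h"
    unfolding onb_def ip_def herm
    using 1 by (auto simp: mult.commute)
  moreover have "h s0 i = v i" if "i \<in> S" for i
  proof (cases "al = 1")
    case True
    then have "u i = 0" using nu nsq_0_iff[OF fin, of u] that by simp
    then show ?thesis by (simp add: h_def u_def)
  next
    case False
    then have "of_real c * (of_real al - 1) = (- 1 :: complex)"
    proof -
      have "c * (al - 1) = -1" using False by (simp add: c_def nu field_simps)
      then show ?thesis by (metis of_real_1 of_real_diff of_real_minus of_real_mult)
    qed
    moreover have "cnj (u s0) = of_real al - 1" by (simp add: u_def vs0)
    moreover have "of_real c * (u i * (of_real al - 1)) = (of_real c * (of_real al - 1)) * u i"
      by (simp only: ac_simps)
    ultimately have "of_real c * (u i * cnj (u s0)) = - u i" by (simp only: mult_minus1)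
    then show ?thesis by (simp add: h_def u_def)
  qed
  ultimately show ?thesis by (rule that)
qed

lemma ap_scale: "ap S G (\<lambda>i. c * u i) i = c * ap S G u i"
  by (simp add: ap_def sum_distrib_left mult.left_commute)

text \<open>Induction on the index set: one eigenvector is completed to an orthonormal basis, and in
  that basis the index \<open>s0\<close> splits off, leaving a Hermitian kernel on the rest.\<close>

lemma spectral:
  assumes "finite S" "herm S A"
  shows "\<exists>f s. eigenbasis S A f s"
  using assms
proof (induction S arbitrary: A rule: finite_psubset_induct)
  case (psubset S)
  show ?case
  proof (cases "S = {}")
    case True
    then show ?thesis by (simp add: eigenbasis_def onb_def)
  next
    case False
    then obtain s0 where s0: "s0 \<in> S" by blast
    obtain v c where v: "\<exists>i\<in>S. v i \<noteq> 0" "\<And>i. i \<in> S \<Longrightarrow> ap S A v i = c * v i"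
      using exists_eigenvector[OF psubset.hyps False] by metis
    have nz: "nsq S v \<noteq> 0" using v(1) nsq_0_iff[OF psubset.hyps, of v] by blast
    \<comment> \<open>Besides normalising, \<open>z\<close> rotates the phase so that the component
      at \<open>s0\<close> becomes real, as \<open>onb_extending\<close> requires.\<close>
    define z where "z = (if v s0 = 0 then 1 else cnj (v s0) / cmod (v s0)) / sqrt (nsq S v)"
    define w where "w = (\<lambda>i. z * v i)"
    have "(cmod z)\<^sup>2 = 1 / nsq S v"
      by (simp add: z_def norm_divide power_divide)
    then have w1: "nsq S w = 1" using nz by (simp add: w_def nsq_scale)
    have w2: "Im (w s0) = 0"
    proof -
      have "cnj (v s0) * v s0 = of_real ((cmod (v s0))\<^sup>2)"
        by (metis complex_norm_square mult.commute of_real_power)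
      then have "w s0 = of_real ((cmod (v s0))\<^sup>2 / cmod (v s0) / sqrt (nsq S v))"
        by (simp add: w_def z_def)
      then show ?thesis by (metis Im_complex_of_real)
    qed
    have w3: "ap S A w i = c * w i" if "i \<in> S" for i
      using v(2)[OF that] by (simp add: w_def ap_scale mult.left_commute)
    obtain h where h: "onb S h" "\<And>i. i \<in> S \<Longrightarrow> h s0 i = w i"
      using onb_extending[OF psubset.hyps s0 w1 w2] by blast
    define B where "B = (\<lambda>a b. ip S (h a) (ap S A (h b)))"
    have Bh: "B b a = cnj (B a b)" for a b
    proof -
      have "cnj (B a b) = (\<Sum>i\<in>S. \<Sum>j\<in>S. h a i * cnj (A i j) * cnj (h b j))"
        by (simp add: B_def ip_def ap_def cnj_sum sum_distrib_left mult.assoc)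
      also have "\<dots> = (\<Sum>j\<in>S. \<Sum>i\<in>S. h a i * cnj (A i j) * cnj (h b j))"
        by (rule sum.swap)
      also have "\<dots> = (\<Sum>j\<in>S. \<Sum>i\<in>S. cnj (h b j) * (A j i * h a i))"
      proof (intro sum.cong refl)
        fix i j assume "i \<in> S" "j \<in> S"
        then have "A j i = cnj (A i j)" using psubset.prems unfolding herm_def by blast
        then show "h a i * cnj (A i j) * cnj (h b j) = cnj (h b j) * (A j i * h a i)"
          by (simp only: ac_simps)
      qed
      also have "\<dots> = B b a" by (simp add: B_def ip_def ap_def sum_distrib_left)
      finally show ?thesis ..
    qed
    have Bcol: "B a s0 = c * of_bool (a = s0)" if "a \<in> S" for a
    proof -
      have "ap S A (h s0) i = c * h s0 i" if "i \<in> S" for i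
        using w3[OF that] h(2) that by (simp add: ap_def)
      then have "B a s0 = ip S (h a) (\<lambda>i. c * h s0 i)"
        unfolding B_def by (intro ip_cong) auto
      then show ?thesis using onbD(1)[OF h(1) that s0] by (simp add: ip_scale_right)
    qed
    have cR: "c = of_real (Re c)"
      using Bh[of s0 s0] Bcol[OF s0] by (simp add: complex_eq_iff)
    \<comment> \<open>The column at \<open>s0\<close> vanishes off the diagonal because
      \<open>h s0\<close> is an eigenvector; Hermitian symmetry transfers this to the row.\<close>
    have Brow: "B s0 b = c * of_bool (b = s0)" if "b \<in> S" for b
    proof -
      have "cnj c = c" by (subst cR, subst cR) simp
      then show ?thesis using Bh[where a=b and b=s0] Bcol[OF that] by (cases "b = s0") auto
    qed
    let ?S = "S - {s0}"
    have "herm ?S B" unfolding herm_def using Bh by blast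
    then obtain g s where g: "eigenbasis ?S B g s" using psubset.IH[of ?S B] s0 by blast
    define g' where "g' = (\<lambda>k a. if k = s0 \<or> a = s0 then of_bool (k = a) else g k a)"
    define s' where "s' = (\<lambda>k. if k = s0 then Re c else s k)"
    have fin: "finite ?S" using psubset.hyps by simp
    have S: "(\<Sum>x\<in>S. F x) = F s0 + (\<Sum>x\<in>?S. F x)" for F :: "'a \<Rightarrow> complex"
      using sum.remove[OF psubset.hyps s0] .
    have g's: "g' s0 a = of_bool (s0 = a)" "g' k s0 = of_bool (k = s0)"
       "k \<noteq> s0 \<Longrightarrow> a \<noteq> s0 \<Longrightarrow> g' k a = g k a" for k a
      by (auto simp: g'_def)
    have 1: "(\<Sum>x\<in>?S. cnj (g' k x) * g' l x) =
       (if k = s0 \<or> l = s0 then 0 else (\<Sum>x\<in>?S. cnj (g k x) * g l x))" for k l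
      by (auto simp: g'_def intro!: sum.neutral sum.cong)
    have 2: "(\<Sum>x\<in>?S. r x * (g' x i * cnj (g' x j))) =
       (if i = s0 \<or> j = s0 then 0 else (\<Sum>x\<in>?S. r x * (g x i * cnj (g x j))))" for i j r
      by (auto simp: g'_def intro!: sum.neutral sum.cong)
    note gD = onbD[OF eigenbasisD(1)[OF g]] eigenbasisD(2)[OF g]
    have "onb S g'"
      unfolding onb_def ip_def
    proof (intro conjI ballI)
      fix k l assume "k \<in> S" "l \<in> S"
      then show "(\<Sum>i\<in>S. cnj (g' k i) * g' l i) = of_bool (k = l)"
        using gD(1)[of k l] unfolding S 1 by (auto simp: ip_def g's)
    next
      fix i j assume "i \<in> S" "j \<in> S"
      then show "(\<Sum>k\<in>S. g' k i * cnj (g' k j)) = of_bool (i = j)"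
        using gD(2)[of i j] 2[of "\<lambda>_. 1" i j] unfolding S by (auto simp: g's)
    qed
    moreover have "B i j = (\<Sum>k\<in>S. of_real (s' k) * g' k i * cnj (g' k j))"
      if "i \<in> S" "j \<in> S" for i j
    proof -
      have "(\<Sum>k\<in>?S. of_real (s' k) * (g' k i * cnj (g' k j))) =
        (if i = s0 \<or> j = s0 then 0 else (\<Sum>k\<in>?S. of_real (s k) * (g k i * cnj (g k j))))"
        unfolding 2 by (auto simp: s'_def intro!: sum.cong)
      then show ?thesis
        using gD(3)[of i j] that Brow[of j] Bcol[of i] cR unfolding S mult.assoc
        by (auto simp: g's s'_def)
    qed
    ultimately have "eigenbasis S B g' s'" by (simp add: eigenbasis_def)
    then show ?thesis using eigenbasis_transport[OF psubset.hyps h(1)] unfolding B_def by blast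
  qed
qed

section \<open>The entropy of a positive kernel\<close>

text \<open>Eigenvectors scaled so that the squared norm is the eigenvalue. The index type is free
  and zero vectors are allowed, because \<open>schmidt\<close> produces a family on one side indexed
  by the other.\<close>

definition orth_dec ::
  "'a set \<Rightarrow> ('a \<Rightarrow> 'a \<Rightarrow> complex) \<Rightarrow> 'k set \<Rightarrow> ('k \<Rightarrow> 'a \<Rightarrow> complex) \<Rightarrow> bool" where
  "orth_dec S G K v \<longleftrightarrow> finite K \<and> (\<forall>k\<in>K. \<forall>l\<in>K. k \<noteq> l \<longrightarrow> ip S (v k) (v l) = 0) \<and>
     (\<forall>i\<in>S. \<forall>j\<in>S. G i j = (\<Sum>k\<in>K. v k i * cnj (v k j)))"

lemma orth_dec_ip_ap:
  assumes "orth_dec S G K v"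
  shows "ip S u (ap S G x) = (\<Sum>k\<in>K. ip S (v k) x * ip S u (v k))"
proof -
  have "ip S u (ap S G x) = ip S u (\<lambda>i. \<Sum>k\<in>K. ip S (v k) x * v k i)"
    using assms by (intro ip_cong gram_ap) (auto simp: orth_dec_def)
  then show ?thesis by (simp only: ip_sum_right)
qed

text \<open>\<open>G\<close> multiplies each vector of an orthogonal decomposition by its squared
  norm. Evaluating the form through the left or through the right vector therefore gives two
  expressions, which forces orthogonality whenever the norms differ.\<close>

lemma orth_dec_ip:
  assumes "orth_dec S G K v" "orth_dec S G L w" "k \<in> K" "l \<in> L"
  shows "ip S (v k) (ap S G (w l)) = of_real (nsq S (v k)) * ip S (v k) (w l)"
    and "ip S (v k) (ap S G (w l)) = of_real (nsq S (w l)) * ip S (v k) (w l)"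
proof -
  show "ip S (v k) (ap S G (w l)) = of_real (nsq S (v k)) * ip S (v k) (w l)"
    unfolding orth_dec_ip_ap[OF assms(1)]
    using assms(1,3) by (subst sum.remove[of _ k]) (force simp: orth_dec_def ip_self intro!: sum.neutral)+
  show "ip S (v k) (ap S G (w l)) = of_real (nsq S (w l)) * ip S (v k) (w l)"
    unfolding orth_dec_ip_ap[OF assms(2)]
    using assms(2,4) by (subst sum.remove[of _ l]) (force simp: orth_dec_def ip_self intro!: sum.neutral)+
qed

lemma orth_dec_expand:
  assumes "orth_dec S G K v" "orth_dec S G L w" "k \<in> K"
  shows "(nsq S (v k))\<^sup>2 = (\<Sum>l\<in>L. (cmod (ip S (v k) (w l)))\<^sup>2)"
proof -
  have "of_real ((nsq S (v k))\<^sup>2) = ip S (v k) (ap S G (v k))"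
    using orth_dec_ip(1)[OF assms(1,1,3,3)] by (simp add: ip_self power2_eq_square)
  also have "\<dots> = ip S (v k) (\<lambda>i. \<Sum>l\<in>L. ip S (w l) (v k) * w l i)"
    using assms(2) by (intro ip_cong gram_ap) (auto simp: orth_dec_def)
  also have "\<dots> = of_real (\<Sum>l\<in>L. (cmod (ip S (v k) (w l)))\<^sup>2)"
    by (simp add: ip_sum_right ip_mult_swap cmod_ip_commute[of S "v k"])
  finally show ?thesis by (simp only: of_real_eq_iff)
qed

text \<open>Vectors of the two decompositions with different norms are orthogonal, so the double sum can be
  weighted by either norm.\<close>

lemma orth_dec_unique:
  assumes "orth_dec S G K v" "orth_dec S G L w"
  shows "(\<Sum>k\<in>K. eta (nsq S (v k))) = (\<Sum>l\<in>L. eta (nsq S (w l)))"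
proof -
  \<comment> \<open>The convention \<open>x / 0 = 0\<close> gives \<open>q 0 = 0\<close>, so the
    factorisation of \<open>eta\<close> survives zero vectors.\<close>
  define q where "q x = eta x / x\<^sup>2" for x
  have q: "eta x = x\<^sup>2 * q x" for x by (simp add: q_def eta_def)
  have eq: "(cmod (ip S (v k) (w l)))\<^sup>2 * q (nsq S (v k)) = (cmod (ip S (v k) (w l)))\<^sup>2 * q (nsq S (w l))"
    if "k \<in> K" "l \<in> L" for k l
    using orth_dec_ip[OF assms that] by auto
  have "(\<Sum>k\<in>K. eta (nsq S (v k))) = (\<Sum>k\<in>K. \<Sum>l\<in>L. (cmod (ip S (v k) (w l)))\<^sup>2 * q (nsq S (v k)))"
    by (intro sum.cong refl, subst q, subst orth_dec_expand[OF assms]) (auto simp: sum_distrib_right)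
  also have "\<dots> = (\<Sum>l\<in>L. \<Sum>k\<in>K. (cmod (ip S (w l) (v k)))\<^sup>2 * q (nsq S (w l)))"
    using eq by (subst sum.swap) (auto simp: cmod_ip_commute[of S "w _"] intro!: sum.cong)
  also have "\<dots> = (\<Sum>l\<in>L. eta (nsq S (w l)))"
    by (rule sym, intro sum.cong refl, subst q, subst orth_dec_expand[OF assms(2,1)]) (auto simp: sum_distrib_right)
  finally show ?thesis .
qed

lemma eigenbasis_orth_dec:
  assumes "eigenbasis S G f s" "finite S" "psd S G"
  shows "orth_dec S G S (\<lambda>k i. of_real (sqrt (s k)) * f k i)"
    and "k \<in> S \<Longrightarrow> nsq S (\<lambda>i. of_real (sqrt (s k)) * f k i) = s k"
proof -
  have s: "k \<in> S \<Longrightarrow> 0 \<le> s k" for k using eigenbasis_psd_nonneg[OF assms(2,1,3)] .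
  have sq: "of_real (sqrt (s k)) * x * cnj (of_real (sqrt (s k)) * y) = of_real (s k) * x * cnj y"
    if "k \<in> S" for k and x y :: complex
  proof -
    have "of_real (sqrt (s k)) * x * cnj (of_real (sqrt (s k)) * y) = of_real (sqrt (s k) * sqrt (s k)) * x * cnj y"
      unfolding of_real_mult complex_cnj_mult complex_cnj_complex_of_real by (simp only: ac_simps)
    then show ?thesis using s[OF that] by simp
  qed
  show "orth_dec S G S (\<lambda>k i. of_real (sqrt (s k)) * f k i)"
    unfolding orth_dec_def
  proof (intro conjI ballI impI)
    fix i j assume "i \<in> S" "j \<in> S"
    show "G i j = (\<Sum>k\<in>S. of_real (sqrt (s k)) * f k i * cnj (of_real (sqrt (s k)) * f k j))"
      unfolding eigenbasisD(2)[OF assms(1) \<open>i \<in> S\<close> \<open>j \<in> S\<close>] by (intro sum.cong refl sq[symmetric])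
  qed (use assms(2) onbD(1)[OF eigenbasisD(1)[OF assms(1)]] in \<open>auto simp: ip_scale_left ip_scale_right\<close>)
  show "nsq S (\<lambda>i. of_real (sqrt (s k)) * f k i) = s k" if "k \<in> S"
    using s[OF that] onb_nsq[OF eigenbasisD(1)[OF assms(1)] that] by (simp add: nsq_scale)
qed

text \<open>For positive kernels the chosen value does not depend on the eigenbasis, see
  \<open>kernel_entropy_orth_dec\<close>. The trace is not normalised, so blocks of a state can be
  treated separately.\<close>

definition kernel_entropy :: "'a set \<Rightarrow> ('a \<Rightarrow> 'a \<Rightarrow> complex) \<Rightarrow> real" where
  "kernel_entropy S G = (SOME h. \<exists>f s. eigenbasis S G f s \<and> h = (\<Sum>k\<in>S. eta (s k)))"

lemma kernel_entropy_witness: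
  assumes "finite S" "herm S G"
  obtains f s where "eigenbasis S G f s" "kernel_entropy S G = (\<Sum>k\<in>S. eta (s k))"
  using someI_ex[of "\<lambda>h. \<exists>f s. eigenbasis S G f s \<and> h = (\<Sum>k\<in>S. eta (s k))"] spectral[OF assms]
  unfolding kernel_entropy_def by blast

lemma orth_dec_psd: "orth_dec S G K v \<Longrightarrow> psd S G"
  by (rule psd_gram[of S G v K]) (auto simp: orth_dec_def)

lemma kernel_entropy_orth_dec:
  assumes "finite S" "orth_dec S G K v"
  shows "kernel_entropy S G = (\<Sum>k\<in>K. eta (nsq S (v k)))"
proof -
  have psd: "psd S G" by (rule orth_dec_psd[OF assms(2)])
  obtain f s where fs: "eigenbasis S G f s" "kernel_entropy S G = (\<Sum>k\<in>S. eta (s k))"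
    using kernel_entropy_witness[OF assms(1)] psd unfolding psd_def by blast
  show ?thesis
    unfolding orth_dec_unique[OF assms(2) eigenbasis_orth_dec(1)[OF fs(1) assms(1) psd]] fs(2)
    using eigenbasis_orth_dec(2)[OF fs(1) assms(1) psd] by (intro sum.cong) auto
qed

text \<open>The conjugated eigenvectors of one marginal, pushed through \<open>U\<close>, are
  orthogonal with the eigenvalues as squared norms, and they decompose the other marginal.
  \<open>A\<close> and \<open>B\<close> may differ in size, the surplus being zero vectors.\<close>

lemma schmidt:
  fixes U :: "'a \<Rightarrow> 'b \<Rightarrow> complex"
  assumes "finite A" "finite B"
  shows "kernel_entropy A (\<lambda>a a'. \<Sum>b\<in>B. U a b * cnj (U a' b)) = kernel_entropy B (\<lambda>b b'. \<Sum>a\<in>A. U a b * cnj (U a b'))"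
    (is "kernel_entropy A ?T = kernel_entropy B ?G")
proof -
  have psd: "psd A ?T" by (rule psd_gram[where v="\<lambda>b a. U a b"]) simp
  obtain f s where fs: "eigenbasis A ?T f s" "kernel_entropy A ?T = (\<Sum>k\<in>A. eta (s k))"
    using kernel_entropy_witness[OF assms(1)] psd unfolding psd_def by blast
  define v where "v k b = (\<Sum>a\<in>A. cnj (f k a) * U a b)" for k b
  have ipv: "ip B (v k) (v l) = of_real (s k) * of_bool (k = l)" if "k \<in> A" "l \<in> A" for k l
  proof -
    have "ip B (v k) (v l) = (\<Sum>b\<in>B. \<Sum>a\<in>A. \<Sum>a'\<in>A. cnj (f l a) * (U a b * cnj (U a' b)) * f k a')"
    proof (unfold ip_def, intro sum.cong refl)
      fix b
      have "cnj (v k b) * v l b = (\<Sum>a\<in>A. cnj (f l a) * U a b) * (\<Sum>a'\<in>A. f k a' * cnj (U a' b))"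
        by (simp add: v_def cnj_sum mult.commute)
      then show "cnj (v k b) * v l b = (\<Sum>a\<in>A. \<Sum>a'\<in>A. cnj (f l a) * (U a b * cnj (U a' b)) * f k a')"
        by (simp add: sum_product ac_simps)
    qed
    also have "\<dots> = (\<Sum>a\<in>A. \<Sum>b\<in>B. \<Sum>a'\<in>A. cnj (f l a) * (U a b * cnj (U a' b)) * f k a')"
      by (rule sum.swap)
    also have "\<dots> = (\<Sum>a\<in>A. \<Sum>a'\<in>A. \<Sum>b\<in>B. cnj (f l a) * (U a b * cnj (U a' b)) * f k a')"
      by (intro sum.cong refl sum.swap)
    also have "\<dots> = ip A (f l) (ap A ?T (f k))"
      by (simp add: ip_def ap_def sum_distrib_left sum_distrib_right mult.assoc)
    also have "\<dots> = of_real (s l) * of_bool (l = k)"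
      using onbD(1)[OF eigenbasisD(1)[OF fs(1)]] that by (simp add: eigenbasis_ip[OF assms(1) fs(1)])
    finally show ?thesis by auto
  qed
  have "orth_dec B ?G A v"
    unfolding orth_dec_def
  proof (intro conjI ballI impI)
    fix b b' assume "b \<in> B" "b' \<in> B"
    have "(\<Sum>k\<in>A. v k b * cnj (v k b')) =
      (\<Sum>k\<in>A. \<Sum>a\<in>A. \<Sum>a'\<in>A. (f k a' * cnj (f k a)) * (U a b * cnj (U a' b')))"
      by (simp add: v_def cnj_sum sum_product ac_simps)
    also have "\<dots> = (\<Sum>a\<in>A. \<Sum>k\<in>A. \<Sum>a'\<in>A. (f k a' * cnj (f k a)) * (U a b * cnj (U a' b')))"
      by (rule sum.swap)
    also have "\<dots> = (\<Sum>a\<in>A. \<Sum>a'\<in>A. \<Sum>k\<in>A. (f k a' * cnj (f k a)) * (U a b * cnj (U a' b')))"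
      by (intro sum.cong refl sum.swap)
    also have "\<dots> = (\<Sum>a\<in>A. \<Sum>a'\<in>A. of_bool (a' = a) * (U a b * cnj (U a' b')))"
      unfolding sum_distrib_right[symmetric]
      using onbD(2)[OF eigenbasisD(1)[OF fs(1)]] by (intro sum.cong) auto
    also have "\<dots> = (\<Sum>a\<in>A. U a b * cnj (U a b'))"
      using assms by (simp add: sum_of_bool_left)
    finally show "(\<Sum>a\<in>A. U a b * cnj (U a b')) = (\<Sum>k\<in>A. v k b * cnj (v k b'))" ..
  qed (use assms ipv in auto)
  moreover have "nsq B (v k) = s k" if "k \<in> A" for k
    using ipv[OF that that] by (simp add: ip_self)
  ultimately have "kernel_entropy B ?G = (\<Sum>k\<in>A. eta (s k))"
    using kernel_entropy_orth_dec[OF assms(2), of ?G A v] by simp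
  then show ?thesis using fs(2) by simp
qed

text \<open>The shape of a partly measured state: \<open>mu i\<close> is the classical outcome,
  \<open>q i\<close> the quantum index, and outside \<open>D\<close> there is only zero padding, as
  in \<open>reduced\<close>. Eigenvectors of each block, extended by zero from their fibre of
  \<open>mu\<close>, decompose the whole kernel.\<close>

lemma kernel_entropy_block:
  assumes S: "finite S" "D \<subseteq> S" and bij: "bij_betw (\<lambda>i. (mu i, q i)) D (M \<times> Q)"
    and fin: "finite M" "finite Q"
    and psd: "\<And>m. m \<in> M \<Longrightarrow> psd Q (G m)"
    and R: "\<And>i j. i \<in> S \<Longrightarrow> j \<in> S \<Longrightarrow>
      R i j = (if i \<in> D \<and> j \<in> D \<and> mu i = mu j then G (mu i) (q i) (q j) else 0)"
  shows "psd S R" and "kernel_entropy S R = (\<Sum>m\<in>M. kernel_entropy Q (G m))"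
proof -
  have "\<exists>f s. eigenbasis Q (G m) f s \<and> kernel_entropy Q (G m) = (\<Sum>k\<in>Q. eta (s k))" if "m \<in> M" for m
    using kernel_entropy_witness[OF fin(2), of "G m"] psd[OF that] unfolding psd_def by blast
  then obtain f s where fs: "\<And>m. m \<in> M \<Longrightarrow> eigenbasis Q (G m) (f m) (s m)"
    and ks: "\<And>m. m \<in> M \<Longrightarrow> kernel_entropy Q (G m) = (\<Sum>k\<in>Q. eta (s m k))"
    by metis
  define e where "e m k a = of_real (sqrt (s m k)) * f m k a" for m k a
  have dec: "orth_dec Q (G m) Q (e m)" and ne: "\<And>k. k \<in> Q \<Longrightarrow> nsq Q (e m k) = s m k" if "m \<in> M" for m
    using eigenbasis_orth_dec[OF fs[OF that] fin(2) psd[OF that]] by (simp_all add: e_def[abs_def])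
  define v where "v = (\<lambda>(m, k) i. if i \<in> D \<and> mu i = m then e m k (q i) else 0)"
  have muq: "mu i \<in> M" "q i \<in> Q" if "i \<in> D" for i
    using bij_betwE[OF bij] that by auto
  have sumD: "(\<Sum>i\<in>S. if i \<in> D \<and> mu i = m then F (q i) else 0) = (\<Sum>a\<in>Q. F a)"
    if "m \<in> M" for m and F :: "'c \<Rightarrow> 'x::comm_monoid_add"
  proof -
    have "(\<Sum>i\<in>S. if i \<in> D \<and> mu i = m then F (q i) else 0) = (\<Sum>i\<in>D. if mu i = m then F (q i) else 0)"
      using S by (intro sum.mono_neutral_cong_right) auto
    also have "\<dots> = (\<Sum>(n, a)\<in>M \<times> Q. if n = m then F a else 0)"
      using sum.reindex_bij_betw[OF bij, of "\<lambda>(n, a). if n = m then F a else 0"] by simp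
    also have "\<dots> = (\<Sum>a\<in>Q. F a)"
    proof -
      have "(\<Sum>a\<in>Q. if n = m then F a else 0) = (if n = m then \<Sum>a\<in>Q. F a else 0)" for n
        by simp
      then show ?thesis unfolding sum.cartesian_product[symmetric] using fin that by simp
    qed
    finally show ?thesis .
  qed
  have ipv: "ip S (v (m, k)) (v (n, l)) = (if m = n then ip Q (e m k) (e m l) else 0)"
    if "m \<in> M" "n \<in> M" for m n k l
  proof (cases "m = n")
    case True
    have "ip S (v (m, k)) (v (m, l)) = (\<Sum>i\<in>S. if i \<in> D \<and> mu i = m then cnj (e m k (q i)) * e m l (q i) else 0)"
      unfolding ip_def by (intro sum.cong) (auto simp: v_def)
    then show ?thesis using True sumD[OF that(1), of "\<lambda>a. cnj (e m k a) * e m l a"] by (simp add: ip_def)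
  next
    case False
    then show ?thesis unfolding ip_def by (auto simp: v_def intro!: sum.neutral)
  qed
  have dec_R: "orth_dec S R (M \<times> Q) v"
    unfolding orth_dec_def
  proof (intro conjI ballI impI)
    show "finite (M \<times> Q)" using fin by simp
    fix x y assume "x \<in> M \<times> Q" "y \<in> M \<times> Q" "x \<noteq> y"
    then show "ip S (v x) (v y) = 0"
      using ipv dec by (cases x; cases y) (auto simp: orth_dec_def)
  next
    fix i j assume ij: "i \<in> S" "j \<in> S"
    have "(\<Sum>x\<in>M \<times> Q. v x i * cnj (v x j)) = (\<Sum>m\<in>M. \<Sum>k\<in>Q. v (m, k) i * cnj (v (m, k) j))"
      by (simp add: sum.cartesian_product)
    also have "\<dots> = (\<Sum>m\<in>M. if i \<in> D \<and> j \<in> D \<and> mu i = mu j \<and> m = mu i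
        then (\<Sum>k\<in>Q. e m k (q i) * cnj (e m k (q j))) else 0)"
      by (intro sum.cong refl) (auto simp: v_def intro!: sum.neutral)
    also have "\<dots> = (\<Sum>m\<in>M. if m = mu i then
        (if i \<in> D \<and> j \<in> D \<and> mu i = mu j then (\<Sum>k\<in>Q. e m k (q i) * cnj (e m k (q j))) else 0) else 0)"
      by (intro sum.cong refl) auto
    also have "\<dots> = R i j"
      using fin muq dec[of "mu i"] R[OF ij] by (auto simp: orth_dec_def)
    finally show "R i j = (\<Sum>x\<in>M \<times> Q. v x i * cnj (v x j))" ..
  qed
  show "psd S R" by (rule orth_dec_psd[OF dec_R])
  have "kernel_entropy S R = (\<Sum>m\<in>M. \<Sum>k\<in>Q. eta (nsq S (v (m, k))))"
    using kernel_entropy_orth_dec[OF S(1) dec_R] by (simp add: sum.cartesian_product)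
  also have "\<dots> = (\<Sum>m\<in>M. kernel_entropy Q (G m))"
  proof (intro sum.cong refl)
    fix m assume m: "m \<in> M"
    have "complex_of_real (nsq S (v (m, k))) = of_real (s m k)" if "k \<in> Q" for k
      using ipv[OF m m, of k k] ne[OF m that] by (simp add: ip_self)
    then show "(\<Sum>k\<in>Q. eta (nsq S (v (m, k)))) = kernel_entropy Q (G m)"
      using ks[OF m] by simp
  qed
  finally show "kernel_entropy S R = (\<Sum>m\<in>M. kernel_entropy Q (G m))" .
qed

lemma kernel_entropy_zero: "finite S \<Longrightarrow> (\<And>i j. i \<in> S \<Longrightarrow> j \<in> S \<Longrightarrow> G i j = 0) \<Longrightarrow> kernel_entropy S G = 0"
  using kernel_entropy_orth_dec[of S G "{} :: nat set" undefined] by (simp add: orth_dec_def)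

section \<open>Von Neumann entropy through the characteristic polynomial\<close>

lemma order_prod_linear:
  "order z (\<Prod>e\<leftarrow>es. [:- e, 1:]) = count_list es (z :: complex)"
proof (induction es)
  case (Cons e es)
  have nz: "(\<Prod>e\<leftarrow>es. [:- e, 1:]) \<noteq> (0 :: complex poly)"
    by (auto simp: prod_list_zero_iff)
  have "order z [:- e, 1:] = (if z = e then 1 else 0)"
    using order_power_n_n[of e 1] by (auto simp: order_0I)
  moreover have "[:- e, 1:] * (\<Prod>e\<leftarrow>es. [:- e, 1:]) \<noteq> 0" using nz by (simp del: mult_pCons_left)
  ultimately show ?case using Cons order_mult[of "[:- e, 1:]" "\<Prod>e\<leftarrow>es. [:- e, 1:]" z]
    by (simp del: mult_pCons_left)
qed (simp add: order_0I)

lemma sum_count_list: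
  fixes g :: "'a \<Rightarrow> real"
  assumes "finite X" "set es \<subseteq> X"
  shows "sum_list (map g es) = (\<Sum>z\<in>X. real (count_list es z) * g z)"
  using assms(2)
proof (induction es)
  case (Cons e es)
  have "(\<Sum>z\<in>X. real (count_list (e # es) z) * g z) =
      (\<Sum>z\<in>X. (if e = z then g z else 0) + real (count_list es z) * g z)"
    by (intro sum.cong) (auto simp: algebra_simps)
  then show ?case using Cons assms(1) by (simp add: sum.distrib)
qed simp

text \<open>Similarity to the diagonal matrix of eigenvalues turns the characteristic polynomial
  into a product of linear factors, so root orders count how often each eigenvalue occurs in the
  eigenbasis.\<close>

lemma vn_entropy_eq_kernel_entropy:
  assumes "herm {..<n} G"
  shows "vn_entropy (mat n n (\<lambda>(i, j). G i j)) = kernel_entropy {..<n} G"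
proof -
  obtain f s where fs: "eigenbasis {..<n} G f s" "kernel_entropy {..<n} G = (\<Sum>k<n. eta (s k))"
    using kernel_entropy_witness[OF _ assms] by blast
  note onb = onbD[OF eigenbasisD(1)[OF fs(1)]]
  define A where "A = mat n n (\<lambda>(i, j). G i j)"
  define P where "P = mat n n (\<lambda>(i, k). f k i)"
  define Q where "Q = mat n n (\<lambda>(k, i). cnj (f k i))"
  define D where "D = mat n n (\<lambda>(k, l). if k = l then complex_of_real (s k) else 0)"
  have c: "A \<in> carrier_mat n n" "P \<in> carrier_mat n n" "Q \<in> carrier_mat n n" "D \<in> carrier_mat n n"
    by (simp_all add: A_def P_def Q_def D_def)
  have "P * Q = 1\<^sub>m n"
    using onb(2) by (intro eq_matI) (auto simp: P_def Q_def scalar_prod_def atLeast0LessThan)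
  moreover have "Q * P = 1\<^sub>m n"
    using onb(1) by (intro eq_matI) (auto simp: P_def Q_def scalar_prod_def atLeast0LessThan ip_def)
  moreover have "A = P * D * Q"
  proof (rule eq_matI)
    fix i j assume "i < dim_row (P * D * Q)" "j < dim_col (P * D * Q)"
    then have ij: "i < n" "j < n" using c by auto
    have PD: "(P * D) $$ (i, k) = f k i * of_real (s k)" if "k < n" for k
      using that ij by (simp add: P_def D_def scalar_prod_def atLeast0LessThan if_distrib cong: if_cong)
    have "(P * D * Q) $$ (i, j) = (\<Sum>k<n. (P * D) $$ (i, k) * cnj (f k j))"
      using ij c by (auto simp: scalar_prod_def atLeast0LessThan Q_def intro!: sum.cong)
    also have "\<dots> = A $$ (i, j)"
      using ij PD eigenbasisD(2)[OF fs(1)] by (simp add: A_def mult.commute)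
    finally show "A $$ (i, j) = (P * D * Q) $$ (i, j)" ..
  qed (use c in auto)
  ultimately have "similar_mat A D"
    unfolding similar_mat_def similar_mat_wit_def Let_def using c by (intro exI[of _ P] exI[of _ Q]) auto
  moreover have "upper_triangular D" by (auto simp: D_def)
  ultimately have cp: "char_poly A = (\<Prod>e\<leftarrow>diag_mat D. [:- e, 1:])"
    using char_poly_similar char_poly_upper_triangular[OF c(4)] by metis
  define es where "es = map (\<lambda>k. complex_of_real (s k)) [0..<n]"
  have es: "diag_mat D = es" by (simp add: diag_mat_def D_def es_def)
  have root: "poly (\<Prod>e\<leftarrow>es. [:- e, 1:]) z = 0 \<longleftrightarrow> z \<in> set es" for z :: complex and es
    by (induction es) auto
  have "vn_entropy A = (\<Sum>z\<in>set es. real (count_list es z) * eta (Re z))"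
    unfolding vn_entropy_def cp es order_prod_linear root by simp
  also have "\<dots> = sum_list (map (\<lambda>z. eta (Re z)) es)"
    by (rule sum_count_list[symmetric]) auto
  also have "\<dots> = (\<Sum>k<n. eta (s k))"
    by (simp add: es_def o_def sum_list_distinct_conv_sum_set atLeast0LessThan)
  finally show ?thesis using fs(2) by (simp add: A_def)
qed

section \<open>Relative entropy bounds\<close>

text \<open>The scalar form of Klein's inequality, from \<open>ln t \<le> t - 1\<close> at
  \<open>t = s / lam\<close>, where equality forces \<open>t = 1\<close>. The weight
  \<open>w\<close> is included because at \<open>s = 0\<close> only the product
  \<open>lam * w\<close> is known to vanish.\<close>

lemma entropy_upper_pointwise:
  fixes lam s w :: real
  assumes "0 \<le> lam" "0 \<le> s" "0 \<le> w" "s = 0 \<Longrightarrow> lam * w = 0"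
  shows "w * eta lam \<le> - (lam * w) * log 2 s + (s * w - lam * w) / ln 2"
    and "w * eta lam = - (lam * w) * log 2 s + (s * w - lam * w) / ln 2 \<Longrightarrow> w = 0 \<or> lam = s"
proof -
  have *: "eta lam \<le> - lam * log 2 s + (s - lam) / ln 2 \<and>
      (eta lam = - lam * log 2 s + (s - lam) / ln 2 \<longrightarrow> lam = s)" if "w \<noteq> 0"
  proof (cases "lam = 0")
    case True
    then show ?thesis using assms by (auto simp: eta_def)
  next
    case False
    then have lam: "lam > 0" and s: "s > 0" using assms that by (auto simp: less_le)
    have "ln (s / lam) \<le> s / lam - 1" using lam s by (intro ln_le_minus_one) simp
    then have 1: "lam * (ln s - ln lam) \<le> s - lam"
      using lam s by (simp add: ln_div field_simps)
    have 2: "lam = s" if "lam * (ln s - ln lam) = s - lam"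
    proof -
      have "ln (s / lam) = s / lam - 1" using that lam s by (simp add: ln_div field_simps)
      then have "s / lam = 1" using lam s by (intro ln_eq_minus_one) auto
      then show ?thesis using lam by simp
    qed
    have "- lam * log 2 s + (s - lam) / ln 2 - eta lam = ((s - lam) - lam * (ln s - ln lam)) / ln 2"
      using lam by (simp add: eta_def log_def field_simps)
    then show ?thesis using 1 2
      by (smt (verit, best) divide_eq_0_iff divide_nonneg_pos ln_gt_zero)
  qed
  have e: "- (lam * w) * log 2 s + (s * w - lam * w) / ln 2 = w * (- lam * log 2 s + (s - lam) / ln 2)"
    by (simp add: field_simps)
  show "w * eta lam \<le> - (lam * w) * log 2 s + (s * w - lam * w) / ln 2"
    unfolding e using * assms(3) by (cases "w = 0") (auto intro: mult_left_mono)
  show "w * eta lam = - (lam * w) * log 2 s + (s * w - lam * w) / ln 2 \<Longrightarrow> w = 0 \<or> lam = s"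
    unfolding e using * by auto
qed

text \<open>The same logarithm bound at the inverse ratio \<open>lam / s\<close>, which produces the
  quadratic term \<open>lam\<^sup>2 / s\<close>.\<close>

lemma entropy_lower_pointwise:
  fixes lam s w :: real
  assumes "0 \<le> lam" "0 \<le> s" "0 \<le> w" "s = 0 \<Longrightarrow> lam * w = 0"
  shows "- (lam * w) * log 2 s - (lam\<^sup>2 * w / s - lam * w) / ln 2 \<le> w * eta lam"
proof (cases "lam = 0 \<or> w = 0")
  case True
  then show ?thesis by (auto simp: eta_def)
next
  case False
  then have lam: "lam > 0" and s: "s > 0" and w: "w > 0" using assms by (auto simp: less_le)
  have "ln (lam / s) \<le> lam / s - 1" using lam s by (intro ln_le_minus_one) simp
  then have "0 \<le> w * lam * ((lam / s - 1) - (ln lam - ln s)) / ln 2"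
    using lam s w by (intro divide_nonneg_pos mult_nonneg_nonneg) (auto simp: ln_div)
  also have "\<dots> = w * eta lam - (- (lam * w) * log 2 s - (lam\<^sup>2 * w / s - lam * w) / ln 2)"
    using lam s by (simp add: eta_def log_def field_simps power2_eq_square)
  finally show ?thesis by simp
qed

text \<open>The squared overlaps are doubly stochastic. Under them the first and second moments of
  the eigenvalues of \<open>A\<close> are the diagonal entry at \<open>f l\<close> and the squared
  norm of \<open>A\<close> applied to \<open>f l\<close>; this is how traces of noncommuting
  operators become scalar sums.\<close>

lemma eigenbasis_weights:
  assumes "finite S" "eigenbasis S A e lam" "onb S f"
  defines "w \<equiv> \<lambda>k l. (cmod (ip S (e k) (f l)))\<^sup>2"
  shows "l \<in> S \<Longrightarrow> (\<Sum>k\<in>S. w k l) = 1" and "k \<in> S \<Longrightarrow> (\<Sum>l\<in>S. w k l) = 1"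
    and "(\<Sum>k\<in>S. lam k * w k l) = Re (ip S (f l) (ap S A (f l)))"
    and "(\<Sum>k\<in>S. (lam k)\<^sup>2 * w k l) = nsq S (ap S A (f l))"
proof -
  show "(\<Sum>k\<in>S. w k l) = 1" if "l \<in> S"
    using parseval_nsq[OF assms(1) eigenbasisD(1)[OF assms(2)], of "f l"] onb_nsq[OF assms(3) that]
    by (simp add: w_def)
  show "(\<Sum>l\<in>S. w k l) = 1" if "k \<in> S"
    using parseval_nsq[OF assms(1) assms(3), of "e k"] onb_nsq[OF eigenbasisD(1)[OF assms(2)] that]
    by (simp add: w_def cmod_ip_commute[of S "e k"])
qed (simp_all add: w_def eigenbasis_quadratic[OF assms(1,2)] eigenbasis_nsq_ap[OF assms(1,2)])

context
  fixes S :: "'a set" and A f and s :: "'a \<Rightarrow> real" and a :: "'a \<Rightarrow> real"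
  assumes fin: "finite S" and psd: "psd S A" and onb: "onb S f"
    and s: "\<And>l. l \<in> S \<Longrightarrow> 0 \<le> s l"
    and supp: "\<And>l. l \<in> S \<Longrightarrow> s l = 0 \<Longrightarrow> a l = 0"
    and a: "\<And>l. l \<in> S \<Longrightarrow> a l = Re (ip S (f l) (ap S A (f l)))"
begin

text \<open>\<open>f\<close> and \<open>s\<close> are the spectral data of a reference operator, and
  \<open>a\<close> is the diagonal of \<open>A\<close> in its eigenbasis, so the sum of
  \<open>a l * log 2 (s l)\<close> is the trace of \<open>A\<close> times the logarithm of the
  reference. As no trace is normalised, the difference of the traces appears as a correction. In the
  equality case only equal eigenvalues overlap, so each \<open>f l\<close> is an eigenvector of
  \<open>A\<close>.\<close>

lemma klein:
  shows "kernel_entropy S A \<le> - (\<Sum>l\<in>S. a l * log 2 (s l)) + ((\<Sum>l\<in>S. s l) - (\<Sum>l\<in>S. a l)) / ln 2"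
      (is "_ \<le> ?R")
    and "kernel_entropy S A = - (\<Sum>l\<in>S. a l * log 2 (s l)) + ((\<Sum>l\<in>S. s l) - (\<Sum>l\<in>S. a l)) / ln 2 \<Longrightarrow>
      l \<in> S \<Longrightarrow> i \<in> S \<Longrightarrow> ap S A (f l) i = of_real (s l) * f l i"
    and kernel_entropy_lower: "- (\<Sum>l\<in>S. a l * log 2 (s l))
       - ((\<Sum>l\<in>S. nsq S (ap S A (f l)) / s l) - (\<Sum>l\<in>S. a l)) / ln 2 \<le> kernel_entropy S A"
      (is "?L \<le> _")
proof -
  obtain e lam where eig: "eigenbasis S A e lam" and kernel_entropy: "kernel_entropy S A = (\<Sum>k\<in>S. eta (lam k))"
    using kernel_entropy_witness[OF fin] psd unfolding psd_def by blast
  have lam: "k \<in> S \<Longrightarrow> 0 \<le> lam k" for k by (rule eigenbasis_psd_nonneg[OF fin eig psd])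
  define w where "w k l = (cmod (ip S (e k) (f l)))\<^sup>2" for k l
  note W = eigenbasis_weights[OF fin eig onb, folded w_def]
  have w0: "0 \<le> w k l" for k l by (simp add: w_def)
  have aw: "l \<in> S \<Longrightarrow> (\<Sum>k\<in>S. lam k * w k l) = a l" for l using W(3) a by simp
  \<comment> \<open>On the kernel of the reference operator, the default values of
    \<open>log 2 0\<close> and of division by zero are only ever multiplied by zero.\<close>
  have sw: "lam k * w k l = 0" if "k \<in> S" "l \<in> S" "s l = 0" for k l
  proof -
    have "(\<Sum>k\<in>S. lam k * w k l) = 0" using aw supp that by simp
    then show ?thesis using sum_nonneg_eq_0_iff[OF fin, of "\<lambda>k. lam k * w k l"] lam w0 that by auto
  qed
  have kent2: "kernel_entropy S A = (\<Sum>k\<in>S. \<Sum>l\<in>S. w k l * eta (lam k))"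
    unfolding kernel_entropy by (intro sum.cong refl) (simp add: W(2) flip: sum_distrib_right)
  define r where "r = (\<lambda>k l. - (lam k * w k l) * log 2 (s l) + (s l * w k l - lam k * w k l) / ln 2)"
  have le: "w k l * eta (lam k) \<le> r k l" and eq: "w k l * eta (lam k) = r k l \<Longrightarrow> w k l = 0 \<or> lam k = s l"
    if "k \<in> S" "l \<in> S" for k l
    unfolding r_def using entropy_upper_pointwise[of "lam k" "s l" "w k l"] lam s w0 sw that by blast+
  have sum_r: "(\<Sum>k\<in>S. \<Sum>l\<in>S. r k l) = ?R"
  proof -
    have "(\<Sum>k\<in>S. \<Sum>l\<in>S. r k l) = (\<Sum>l\<in>S. \<Sum>k\<in>S. r k l)" by (rule sum.swap)
    also have "\<dots> = (\<Sum>l\<in>S. - (\<Sum>k\<in>S. lam k * w k l) * log 2 (s l)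
        + (s l * (\<Sum>k\<in>S. w k l) - (\<Sum>k\<in>S. lam k * w k l)) / ln 2)"
      by (simp add: r_def sum.distrib sum_subtractf sum_negf sum_distrib_left sum_distrib_right sum_divide_distrib diff_divide_distrib)
    also have "\<dots> = (\<Sum>l\<in>S. - (a l * log 2 (s l)) + (s l - a l) / ln 2)"
      by (intro sum.cong refl) (simp add: aw W(1))
    also have "\<dots> = ?R"
      by (simp add: sum.distrib sum_negf sum_divide_distrib[symmetric] sum_subtractf)
    finally show ?thesis .
  qed
  show "kernel_entropy S A \<le> ?R"
    unfolding kent2 sum_r[symmetric] by (intro sum_mono le)
  show "ap S A (f l) i = of_real (s l) * f l i" if "kernel_entropy S A = ?R" and l: "l \<in> S" and i: "i \<in> S" for l i
  proof -
    have "(\<Sum>k\<in>S. \<Sum>l\<in>S. r k l - w k l * eta (lam k)) = 0"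
      using that(1) unfolding kent2 sum_r[symmetric] by (simp add: sum_subtractf)
    then have "\<forall>k\<in>S. (\<Sum>l\<in>S. r k l - w k l * eta (lam k)) = 0"
      using le by (subst (asm) sum_nonneg_eq_0_iff[OF fin]) (auto intro!: sum_nonneg)
    then have "r k l - w k l * eta (lam k) = 0" if "k \<in> S" for k
      using sum_nonneg_eq_0_iff[OF fin, of "\<lambda>l. r k l - w k l * eta (lam k)"] le that l by auto
    then have "w k l = 0 \<or> lam k = s l" if "k \<in> S" for k
      using eq that l by auto
    then have "ip S (e k) (ap S A (f l)) = of_real (s l) * ip S (e k) (f l)" if "k \<in> S" for k
      using that by (auto simp: eigenbasis_ip[OF fin eig] w_def)
    then show ?thesis
      unfolding onb_expand[OF fin eigenbasisD(1)[OF eig] i, of "ap S A (f l)"]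
        onb_expand[OF fin eigenbasisD(1)[OF eig] i, of "f l"]
      by (simp add: sum_distrib_left mult.assoc)
  qed
  define q where "q = (\<lambda>k l. - (lam k * w k l) * log 2 (s l) - ((lam k)\<^sup>2 * w k l / s l - lam k * w k l) / ln 2)"
  have "?L = (\<Sum>l\<in>S. - (a l * log 2 (s l)) - (nsq S (ap S A (f l)) / s l - a l) / ln 2)"
    by (simp add: sum_subtractf sum_negf sum_divide_distrib[symmetric])
  also have "\<dots> = (\<Sum>l\<in>S. - (\<Sum>k\<in>S. lam k * w k l) * log 2 (s l)
        - ((\<Sum>k\<in>S. (lam k)\<^sup>2 * w k l) / s l - (\<Sum>k\<in>S. lam k * w k l)) / ln 2)"
    by (intro sum.cong refl) (simp add: aw W(4))
  also have "\<dots> = (\<Sum>l\<in>S. \<Sum>k\<in>S. q k l)"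
    by (simp add: q_def sum.distrib sum_subtractf sum_negf sum_distrib_left sum_distrib_right sum_divide_distrib diff_divide_distrib)
  also have "\<dots> = (\<Sum>k\<in>S. \<Sum>l\<in>S. q k l)" by (rule sum.swap)
  also have "\<dots> \<le> (\<Sum>k\<in>S. \<Sum>l\<in>S. w k l * eta (lam k))"
    unfolding q_def using lam s w0 sw by (intro sum_mono entropy_lower_pointwise) auto
  also have "\<dots> = kernel_entropy S A" by (rule kent2[symmetric])
  finally show "?L \<le> kernel_entropy S A" .
qed

end

section \<open>Entropy of mixtures and its equality case\<close>

lemma eigenbasis_trace:
  assumes "finite S" "eigenbasis S G f s"
  shows "(\<Sum>k\<in>S. s k) = (\<Sum>i\<in>S. Re (G i i))"
proof -
  have "(\<Sum>i\<in>S. G i i) = (\<Sum>i\<in>S. \<Sum>k\<in>S. of_real (s k) * (cnj (f k i) * f k i))"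
    using eigenbasisD(2)[OF assms(2)] by (intro sum.cong refl) (simp add: ac_simps)
  also have "\<dots> = (\<Sum>k\<in>S. of_real (s k) * ip S (f k) (f k))"
    by (subst sum.swap) (simp add: ip_def sum_distrib_left)
  also have "\<dots> = of_real (\<Sum>k\<in>S. s k)"
    using onbD(1)[OF eigenbasisD(1)[OF assms(2)]] by simp
  finally show ?thesis by (metis Re_complex_of_real Re_sum)
qed

lemma ap_onb_kernel:
  assumes "finite S" "onb S f" "i \<in> S" "j \<in> S"
  shows "G i j = (\<Sum>l\<in>S. ap S G (f l) i * cnj (f l j))"
proof -
  have "(\<Sum>l\<in>S. ap S G (f l) i * cnj (f l j)) = (\<Sum>m\<in>S. G i m * (\<Sum>l\<in>S. f l m * cnj (f l j)))"
    unfolding ap_def sum_distrib_right sum_distrib_left by (subst sum.swap) (simp add: mult.assoc)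
  also have "\<dots> = (\<Sum>m\<in>S. G i m * of_bool (m = j))"
    using onbD(2)[OF assms(2)] assms by (intro sum.cong) auto
  finally show ?thesis using assms by (simp add: sum_of_bool_left)
qed

lemma ap_sum_kernel:
  assumes "\<And>i j. i \<in> S \<Longrightarrow> j \<in> S \<Longrightarrow> G i j = (\<Sum>x\<in>I. H x i j)" "i \<in> S"
  shows "ap S G u i = (\<Sum>x\<in>I. ap S (H x) u i)"
proof -
  have "ap S G u i = (\<Sum>j\<in>S. \<Sum>x\<in>I. H x i j * u j)"
    using assms by (simp add: ap_def sum_distrib_right)
  also have "\<dots> = (\<Sum>x\<in>I. ap S (H x) u i)"
    unfolding ap_def by (rule sum.swap)
  finally show ?thesis .
qed

lemma ip_ap_sum_kernel:
  assumes "\<And>i j. i \<in> S \<Longrightarrow> j \<in> S \<Longrightarrow> G i j = (\<Sum>x\<in>I. H x i j)"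
  shows "ip S v (ap S G u) = (\<Sum>x\<in>I. ip S v (ap S (H x) u))"
proof -
  have "ip S v (ap S G u) = ip S v (\<lambda>i. \<Sum>x\<in>I. 1 * ap S (H x) u i)"
    using ap_sum_kernel[of S G H I, OF assms] by (intro ip_cong) auto
  then show ?thesis unfolding ip_sum_right by simp
qed

lemma psd_sum:
  assumes "\<And>i j. i \<in> S \<Longrightarrow> j \<in> S \<Longrightarrow> G i j = (\<Sum>x\<in>I. H x i j)" "\<And>x. x \<in> I \<Longrightarrow> psd S (H x)"
  shows "psd S G"
proof -
  have "G j i = cnj (G i j)" if "i \<in> S" "j \<in> S" for i j
  proof -
    have "H x j i = cnj (H x i j)" if "x \<in> I" for x
      using assms(2)[OF that] \<open>i \<in> S\<close> \<open>j \<in> S\<close> unfolding psd_def herm_def by blast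
    then show ?thesis using assms(1) that by (simp add: cnj_sum)
  qed
  moreover have "0 \<le> Re (ip S u (ap S G u))" for u
  proof -
    have "ip S u (ap S G u) = (\<Sum>x\<in>I. ip S u (ap S (H x) u))"
      by (rule ip_ap_sum_kernel) (rule assms(1))
    then show ?thesis using assms(2) by (auto simp: psd_def intro!: sum_nonneg)
  qed
  ultimately show ?thesis unfolding psd_def herm_def by blast
qed

text \<open>Given the quantum system, the label \<open>x\<close> carries at most
  \<open>log 2 (card I)\<close> bits of entropy. Klein's inequality is applied to every
  \<open>H x\<close> with the common reference \<open>G\<close> divided by the number of labels, and
  the results are summed; equality in the sum forces equality in each term.\<close>

lemma kernel_entropy_mixture:
  assumes fin: "finite S" "finite I" and N: "I \<noteq> {}"
    and H: "\<And>x. x \<in> I \<Longrightarrow> psd S (H x)"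
    and G: "\<And>i j. i \<in> S \<Longrightarrow> j \<in> S \<Longrightarrow> G i j = (\<Sum>x\<in>I. H x i j)"
  shows "(\<Sum>x\<in>I. kernel_entropy S (H x)) \<le> kernel_entropy S G + (\<Sum>i\<in>S. Re (G i i)) * log 2 (card I)"
    and "(\<Sum>x\<in>I. kernel_entropy S (H x)) = kernel_entropy S G + (\<Sum>i\<in>S. Re (G i i)) * log 2 (card I) \<Longrightarrow>
      x \<in> I \<Longrightarrow> i \<in> S \<Longrightarrow> j \<in> S \<Longrightarrow> H x i j = G i j / of_nat (card I)"
proof -
  define n where "n = real (card I)"
  have n: "n > 0" using fin N by (simp add: n_def card_gt_0_iff)
  have psd: "psd S G" by (rule psd_sum[OF G H])
  obtain f s where fs: "eigenbasis S G f s" "kernel_entropy S G = (\<Sum>k\<in>S. eta (s k))"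
    using kernel_entropy_witness[OF fin(1)] psd unfolding psd_def by blast
  note onb = eigenbasisD(1)[OF fs(1)]
  have s: "k \<in> S \<Longrightarrow> 0 \<le> s k" for k by (rule eigenbasis_psd_nonneg[OF fin(1) fs(1) psd])
  define a where "a x l = Re (ip S (f l) (ap S (H x) (f l)))" for x l
  have a0: "x \<in> I \<Longrightarrow> 0 \<le> a x l" for x l using H by (simp add: a_def psd_def)
  have asum: "(\<Sum>x\<in>I. a x l) = s l" if "l \<in> S" for l
  proof -
    have "(\<Sum>x\<in>I. a x l) = Re (ip S (f l) (ap S G (f l)))"
      unfolding a_def using ip_ap_sum_kernel[of S G H I "f l" "f l", OF G] by simp
    then show ?thesis using eigenbasis_ip[OF fin(1) fs(1) that, of "f l"] onbD(1)[OF onb that that] by simp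
  qed
  define t where "t l = s l / n" for l
  have t0: "l \<in> S \<Longrightarrow> 0 \<le> t l" for l using s n by (simp add: t_def)
  have supp: "a x l = 0" if "x \<in> I" "l \<in> S" "t l = 0" for x l
    using asum[OF that(2)] sum_nonneg_eq_0_iff[OF fin(2), of "\<lambda>x. a x l"] a0 that n by (simp add: t_def)
  define b where "b x = - (\<Sum>l\<in>S. a x l * log 2 (t l)) + ((\<Sum>l\<in>S. t l) - (\<Sum>l\<in>S. a x l)) / ln 2" for x
  have le: "kernel_entropy S (H x) \<le> b x" if "x \<in> I" for x
    unfolding b_def
    by (rule klein(1)[where f=f and a="a x" and s=t, OF fin(1) H[OF that] onb t0 supp[OF that] a_def])
  have eq: "ap S (H x) (f l) i = of_real (t l) * f l i"
    if "x \<in> I" "kernel_entropy S (H x) = b x" "l \<in> S" "i \<in> S" for x l i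
    by (rule klein(2)[where f=f and a="a x" and s=t, OF fin(1) H[OF that(1)] onb t0 supp[OF that(1)]
          a_def that(2)[unfolded b_def] that(3,4)])
  have tr: "(\<Sum>l\<in>S. s l) = (\<Sum>i\<in>S. Re (G i i))" by (rule eigenbasis_trace[OF fin(1) fs(1)])
  \<comment> \<open>The diagonals of the \<open>H x\<close> add up to the spectrum of
    \<open>G\<close>, so the logarithm of \<open>s l / n\<close> separates into the entropy of
    \<open>G\<close> and the trace times \<open>log 2 n\<close>.\<close>
  have "(\<Sum>x\<in>I. \<Sum>l\<in>S. a x l * log 2 (t l)) = (\<Sum>l\<in>S. s l * log 2 (t l))"
    by (subst sum.swap) (simp add: asum flip: sum_distrib_right)
  also have "\<dots> = (\<Sum>l\<in>S. - eta (s l) - s l * log 2 n)"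
  proof (intro sum.cong refl)
    fix l assume "l \<in> S"
    then show "s l * log 2 (t l) = - eta (s l) - s l * log 2 n"
      using s[of l] n by (cases "s l = 0") (auto simp: t_def eta_def log_divide algebra_simps)
  qed
  finally have "(\<Sum>x\<in>I. \<Sum>l\<in>S. a x l * log 2 (t l)) = - kernel_entropy S G - (\<Sum>l\<in>S. s l) * log 2 n"
    by (simp add: fs(2) sum_subtractf sum_negf sum_distrib_right)
  moreover have "(\<Sum>x\<in>I. ((\<Sum>l\<in>S. t l) - (\<Sum>l\<in>S. a x l)) / ln 2) = 0"
  proof -
    have "(\<Sum>x\<in>I. \<Sum>l\<in>S. a x l) = (\<Sum>l\<in>S. s l)"
      by (subst sum.swap) (simp add: asum)
    moreover have "n * (\<Sum>l\<in>S. t l) = (\<Sum>l\<in>S. s l)"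
      using n by (simp add: t_def flip: sum_divide_distrib)
    ultimately show ?thesis
      by (simp add: sum_subtractf n_def flip: sum_divide_distrib)
  qed
  ultimately have sb: "(\<Sum>x\<in>I. b x) = kernel_entropy S G + (\<Sum>i\<in>S. Re (G i i)) * log 2 n"
    by (simp add: b_def sum.distrib sum_subtractf sum_negf tr)
  show "(\<Sum>x\<in>I. kernel_entropy S (H x)) \<le> kernel_entropy S G + (\<Sum>i\<in>S. Re (G i i)) * log 2 (card I)"
    unfolding n_def[symmetric] sb[symmetric] by (intro sum_mono le)
  show "H x i j = G i j / of_nat (card I)"
    if "(\<Sum>x\<in>I. kernel_entropy S (H x)) = kernel_entropy S G + (\<Sum>i\<in>S. Re (G i i)) * log 2 (card I)"
      and x: "x \<in> I" and ij: "i \<in> S" "j \<in> S" for x i j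
  proof -
    have "(\<Sum>x\<in>I. b x - kernel_entropy S (H x)) = 0"
      using that(1) unfolding n_def[symmetric] sb[symmetric] by (simp add: sum_subtractf)
    then have kx: "kernel_entropy S (H x) = b x"
      using sum_nonneg_eq_0_iff[OF fin(2), of "\<lambda>x. b x - kernel_entropy S (H x)"] le x by auto
    have "H x i j = (\<Sum>l\<in>S. of_real (t l) * f l i * cnj (f l j))"
      unfolding ap_onb_kernel[OF fin(1) onb ij, of "H x"]
      using eq[OF x kx _ ij(1)] by (intro sum.cong) auto
    also have "\<dots> = (\<Sum>l\<in>S. of_real (s l) * f l i * cnj (f l j)) / of_nat (card I)"
      by (simp add: t_def n_def sum_divide_distrib)
    finally show ?thesis using eigenbasisD(2)[OF fs(1)] ij by simp
  qed
qed

text \<open>With at most one nonzero summand there are no cross terms. This is applied to an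
  off-diagonal block, whose only contribution comes from the common neighbour
  \<open>x\<close>.\<close>

lemma nsq_sum_at_most_one:
  assumes "finite X" "\<And>x x'. x \<in> X \<Longrightarrow> x' \<in> X \<Longrightarrow> P x \<Longrightarrow> P x' \<Longrightarrow> x = x'"
    and "\<And>x i. x \<in> X \<Longrightarrow> \<not> P x \<Longrightarrow> i \<in> S \<Longrightarrow> c x i = 0"
  shows "nsq S (\<lambda>i. \<Sum>x\<in>X. c x i) = (\<Sum>x\<in>X. nsq S (c x))"
proof (cases "\<exists>x\<in>X. P x")
  case True
  then obtain x where x: "x \<in> X" "P x" by blast
  then have 0: "c x' i = 0" if "x' \<in> X - {x}" "i \<in> S" for x' i
    using assms(2,3) that by blast
  have "nsq S (\<lambda>i. \<Sum>x\<in>X. c x i) = nsq S (c x)"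
  proof (rule nsq_cong)
    fix i assume "i \<in> S"
    then show "(\<Sum>x\<in>X. c x i) = c x i"
      using 0 by (simp add: sum.remove[OF assms(1) x(1)])
  qed
  moreover have "(\<Sum>x\<in>X. nsq S (c x)) = nsq S (c x)"
    using 0 by (simp add: sum.remove[OF assms(1) x(1)] nsq_def)
  ultimately show ?thesis by simp
qed (use assms(3) in \<open>simp add: nsq_def\<close>)

section \<open>Pure states over a bipartite support graph\<close>

text \<open>\<open>E x y\<close> is the support relation; for oblivious transfer of \<open>r\<close>-bit strings \<open>N = 2^r\<close>.\<close>

locale bipartite_state =
  fixes X Y A B :: "nat set" and psi :: "nat \<Rightarrow> nat \<Rightarrow> nat \<Rightarrow> nat \<Rightarrow> complex"
    and E :: "nat \<Rightarrow> nat \<Rightarrow> bool" and N :: nat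
  assumes fin: "finite X" "finite Y" "finite A" "finite B"
    and zero: "\<lbrakk>x \<in> X; y \<in> Y; \<not> E x y; a \<in> A; b \<in> B\<rbrakk> \<Longrightarrow> psi x a y b = 0"
    and Npos: "N > 0"
    and deg_Y: "y \<in> Y \<Longrightarrow> card {x \<in> X. E x y} = N"
    and deg_X: "x \<in> X \<Longrightarrow> card {y \<in> Y. E x y} = 2"
    and no_4_cycle: "\<lbrakk>y \<in> Y; y' \<in> Y; y \<noteq> y'; x \<in> X; x' \<in> X; E x y; E x y'; E x' y; E x' y'\<rbrakk> \<Longrightarrow> x = x'"
    and total: "(\<Sum>x\<in>X. \<Sum>y\<in>Y. \<Sum>a\<in>A. \<Sum>b\<in>B. (cmod (psi x a y b))\<^sup>2) = 1"
begin

text \<open>These are unnormalised: the trace of \<open>G x y\<close> is the probability of \<open>(x, y)\<close>, so entropies of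
  classical-quantum states are plain sums of block entropies.\<close>

definition G :: "nat \<Rightarrow> nat \<Rightarrow> nat \<Rightarrow> nat \<Rightarrow> complex" where
  "G x y b b' = (\<Sum>a\<in>A. psi x a y b * cnj (psi x a y b'))"

definition T :: "nat \<Rightarrow> nat \<Rightarrow> nat \<Rightarrow> nat \<Rightarrow> complex" where
  "T x y a a' = (\<Sum>b\<in>B. psi x a y b * cnj (psi x a' y b))"

definition GY :: "nat \<Rightarrow> nat \<Rightarrow> nat \<Rightarrow> complex" where
  "GY y b b' = (\<Sum>x\<in>X. G x y b b')"

definition TX :: "nat \<Rightarrow> nat \<Rightarrow> nat \<Rightarrow> complex" where
  "TX x a a' = (\<Sum>y\<in>Y. T x y a a')"

text \<open>Unlike in \<open>G\<close>, the coherences between different \<open>y\<close> are kept.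
  The sum \<open>R\<close> is \<rho>, and the diagonal blocks \<open>GY\<close> of \<open>R\<close>
  make up \<sigma>.\<close>

definition RX :: "nat \<Rightarrow> nat \<times> nat \<Rightarrow> nat \<times> nat \<Rightarrow> complex" where
  "RX x p p' = (\<Sum>a\<in>A. psi x a (fst p) (snd p) * cnj (psi x a (fst p') (snd p')))"

definition R :: "nat \<times> nat \<Rightarrow> nat \<times> nat \<Rightarrow> complex" where
  "R p p' = (\<Sum>x\<in>X. RX x p p')"

lemma psd_kernels: "psd B (G x y)" "psd A (T x y)" "psd B (GY y)" "psd A (TX x)"
  "psd (Y \<times> B) (RX x)" "psd (Y \<times> B) R"
proof -
  show G: "psd B (G x y)" for x y
    by (rule psd_gram[where v="\<lambda>a b. psi x a y b"]) (simp add: G_def)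
  show T: "psd A (T x y)" for x y
    by (rule psd_gram[where v="\<lambda>b a. psi x a y b"]) (simp add: T_def)
  show RX: "psd (Y \<times> B) (RX x)" for x
    by (rule psd_gram[where v="\<lambda>a p. psi x a (fst p) (snd p)"]) (simp add: RX_def)
  show "psd B (GY y)" by (rule psd_sum[OF GY_def G])
  show "psd A (TX x)" by (rule psd_sum[OF TX_def T])
  show "psd (Y \<times> B) R" by (rule psd_sum[OF R_def RX])
qed

lemma kernel_entropy_G_T: "kernel_entropy B (G x y) = kernel_entropy A (T x y)"
  unfolding G_def[abs_def] T_def[abs_def] using schmidt[OF fin(3,4), of "\<lambda>a b. psi x a y b"] by simp

text \<open>For fixed \<open>x\<close> the state of \<open>A'BB'\<close> is pure. Seen from
  \<open>A'\<close>, tracing out \<open>B\<close> coherently or after a measurement is the same,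
  hence the sum over \<open>y\<close> in \<open>TX\<close>.\<close>

lemma kernel_entropy_RX_TX: "kernel_entropy (Y \<times> B) (RX x) = kernel_entropy A (TX x)"
proof -
  have "TX x = (\<lambda>a a'. \<Sum>p\<in>Y \<times> B. psi x a (fst p) (snd p) * cnj (psi x a' (fst p) (snd p)))"
    by (simp add: TX_def T_def fun_eq_iff sum.cartesian_product case_prod_beta)
  then show ?thesis
    using schmidt[OF fin(3), of "Y \<times> B" "\<lambda>a p. psi x a (fst p) (snd p)"] fin
    by (simp add: RX_def[abs_def])
qed

lemma trace_GY: "(\<Sum>y\<in>Y. \<Sum>b\<in>B. Re (GY y b b)) = 1"
proof -
  have "Re (GY y b b) = (\<Sum>x\<in>X. \<Sum>a\<in>A. (cmod (psi x a y b))\<^sup>2)" for y b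
    by (simp add: GY_def G_def complex_norm_square[symmetric] flip: of_real_power)
  then have "(\<Sum>y\<in>Y. \<Sum>b\<in>B. Re (GY y b b)) = (\<Sum>y\<in>Y. \<Sum>x\<in>X. \<Sum>b\<in>B. \<Sum>a\<in>A. (cmod (psi x a y b))\<^sup>2)"
    by (simp only: sum.swap[of _ X B])
  also have "\<dots> = 1"
    unfolding total[symmetric] by (subst sum.swap) (simp only: sum.swap[of _ A B])
  finally show ?thesis .
qed

lemma trace_TX: "(\<Sum>x\<in>X. \<Sum>a\<in>A. Re (TX x a a)) = 1"
proof -
  have "Re (TX x a a) = (\<Sum>y\<in>Y. \<Sum>b\<in>B. (cmod (psi x a y b))\<^sup>2)" for x a
    by (simp add: TX_def T_def complex_norm_square[symmetric] flip: of_real_power)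
  then show ?thesis unfolding total[symmetric] by (simp only: sum.swap[of _ A Y])
qed

lemma G_zero: "x \<in> X \<Longrightarrow> y \<in> Y \<Longrightarrow> \<not> E x y \<Longrightarrow> b \<in> B \<Longrightarrow> b' \<in> B \<Longrightarrow> G x y b b' = 0"
  unfolding G_def using zero by (intro sum.neutral) auto

lemma T_zero: "x \<in> X \<Longrightarrow> y \<in> Y \<Longrightarrow> \<not> E x y \<Longrightarrow> a \<in> A \<Longrightarrow> a' \<in> A \<Longrightarrow> T x y a a' = 0"
  unfolding T_def using zero by (intro sum.neutral) auto

text \<open>The hypothesis is Bob's embedding condition with the entropies of the primitive
  inserted. Restricted to the \<open>N\<close> neighbours of \<open>y\<close>, the mixture bound has
  a nonnegative deficit \<open>t y\<close>; the hypothesis makes the deficits sum to zero, so each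
  block is in the equality case.\<close>

lemma G_independent:
  assumes "(\<Sum>x\<in>X. \<Sum>y\<in>Y. kernel_entropy B (G x y)) = (\<Sum>y\<in>Y. kernel_entropy B (GY y)) + log 2 N"
    and "x \<in> X" "y \<in> Y" "E x y" "b \<in> B" "b' \<in> B"
  shows "G x y b b' = GY y b b' / N"
proof -
  define I where "I y = {x \<in> X. E x y}" for y
  have I: "finite (I y)" "y \<in> Y \<Longrightarrow> I y \<noteq> {}" "y \<in> Y \<Longrightarrow> card (I y) = N" for y
  proof -
    show "finite (I y)" using fin by (simp add: I_def)
    show card: "card (I y) = N" if "y \<in> Y" using deg_Y[OF that] by (simp add: I_def)
    show "I y \<noteq> {}" if "y \<in> Y" using card[OF that] Npos by (metis card.empty less_irrefl)
  qed
  have GY: "GY y b b' = (\<Sum>x\<in>I y. G x y b b')" if "y \<in> Y" "b \<in> B" "b' \<in> B" for y b b'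
    unfolding GY_def I_def using fin G_zero that by (intro sum.mono_neutral_right) auto
  have kG: "(\<Sum>x\<in>X. kernel_entropy B (G x y)) = (\<Sum>x\<in>I y. kernel_entropy B (G x y))" if "y \<in> Y" for y
    unfolding I_def using fin G_zero that by (intro sum.mono_neutral_right) (auto intro!: kernel_entropy_zero)
  define t where "t y = kernel_entropy B (GY y) + (\<Sum>b\<in>B. Re (GY y b b)) * log 2 N - (\<Sum>x\<in>I y. kernel_entropy B (G x y))" for y
  have t0: "0 \<le> t y" if "y \<in> Y" for y
    using kernel_entropy_mixture(1)[OF fin(4) I(1) I(2)[OF that], of "\<lambda>x. G x y" "GY y"] psd_kernels GY that I(3)
    by (simp add: t_def)
  have "(\<Sum>x\<in>X. \<Sum>y\<in>Y. kernel_entropy B (G x y)) = (\<Sum>y\<in>Y. \<Sum>x\<in>I y. kernel_entropy B (G x y))"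
    by (subst sum.swap) (simp add: kG)
  then have "(\<Sum>y\<in>Y. t y) = 0"
    using assms(1) trace_GY
    by (simp add: t_def sum.distrib sum_subtractf flip: sum_distrib_right)
  then have "t y = 0" using sum_nonneg_eq_0_iff[OF fin(2), of t] t0 assms(3) by auto
  then show ?thesis
    using kernel_entropy_mixture(2)[OF fin(4) I(1) I(2)[OF assms(3)], of "\<lambda>x. G x y" "GY y" x b b'] psd_kernels GY I(3) assms
    by (simp add: t_def I_def)
qed

text \<open>The same argument from Alice's side; the constant 1 is the logarithm of the two
  neighbours of \<open>x\<close>.\<close>

lemma T_independent:
  assumes "(\<Sum>x\<in>X. \<Sum>y\<in>Y. kernel_entropy A (T x y)) = (\<Sum>x\<in>X. kernel_entropy A (TX x)) + 1"
    and "x \<in> X" "y \<in> Y" "E x y" "a \<in> A" "a' \<in> A"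
  shows "T x y a a' = TX x a a' / 2"
proof -
  define I where "I x = {y \<in> Y. E x y}" for x
  have I: "finite (I x)" "x \<in> X \<Longrightarrow> I x \<noteq> {}" "x \<in> X \<Longrightarrow> card (I x) = 2" for x
  proof -
    show "finite (I x)" using fin by (simp add: I_def)
    show card: "card (I x) = 2" if "x \<in> X" using deg_X[OF that] by (simp add: I_def)
    show "I x \<noteq> {}" if "x \<in> X" using card[OF that] by (metis card.empty zero_neq_numeral)
  qed
  have TX: "TX x b b' = (\<Sum>y\<in>I x. T x y b b')" if "x \<in> X" "b \<in> A" "b' \<in> A" for x b b'
    unfolding TX_def I_def using fin T_zero that by (intro sum.mono_neutral_right) auto
  have kT: "(\<Sum>y\<in>Y. kernel_entropy A (T x y)) = (\<Sum>y\<in>I x. kernel_entropy A (T x y))" if "x \<in> X" for x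
    unfolding I_def using fin T_zero that by (intro sum.mono_neutral_right) (auto intro!: kernel_entropy_zero)
  define t where "t x = kernel_entropy A (TX x) + (\<Sum>a\<in>A. Re (TX x a a)) - (\<Sum>y\<in>I x. kernel_entropy A (T x y))" for x
  have t0: "0 \<le> t x" if "x \<in> X" for x
    using kernel_entropy_mixture(1)[OF fin(3) I(1) I(2)[OF that], of "\<lambda>y. T x y" "TX x"] psd_kernels TX that I(3)
    by (simp add: t_def)
  have "(\<Sum>x\<in>X. t x) = 0"
    using assms(1) kT trace_TX
    by (simp add: t_def sum.distrib sum_subtractf)
  then have "t x = 0" using sum_nonneg_eq_0_iff[OF fin(1), of t] t0 assms(2) by auto
  then show ?thesis
    using kernel_entropy_mixture(2)[OF fin(3) I(1) I(2)[OF assms(2)], of "\<lambda>y. T x y" "TX x" y a a'] psd_kernels TX I(3) assms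
    by (simp add: t_def I_def)
qed

text \<open>The contribution of \<open>x\<close> to the off-diagonal block of \<open>R\<close> from \<open>y\<close> to \<open>y'\<close>. Its norm depends on \<open>y'\<close>
  only through \<open>T x y'\<close>, which is where the independence on Alice's side enters.\<close>

definition C :: "nat \<Rightarrow> nat \<Rightarrow> nat \<Rightarrow> (nat \<Rightarrow> complex) \<Rightarrow> nat \<Rightarrow> complex" where
  "C x y' y u b' = (\<Sum>b\<in>B. (\<Sum>a\<in>A. psi x a y' b' * cnj (psi x a y b)) * u b)"

lemma nsq_C:
  "nsq B (C x y' y u) = Re (\<Sum>a\<in>A. \<Sum>a'\<in>A. T x y' a a' *
     ((\<Sum>b\<in>B. cnj (psi x a y b) * u b) * cnj (\<Sum>b\<in>B. cnj (psi x a' y b) * u b)))"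
proof -
  define m where "m a = (\<Sum>b\<in>B. cnj (psi x a y b) * u b)" for a
  have C: "C x y' y u b' = (\<Sum>a\<in>A. psi x a y' b' * m a)" for b'
    unfolding C_def m_def sum_distrib_right sum_distrib_left
    by (subst sum.swap) (simp add: mult.assoc)
  have "of_real (nsq B (C x y' y u)) = (\<Sum>b\<in>B. C x y' y u b * cnj (C x y' y u b))"
    using ip_self[of B "C x y' y u"] by (simp add: ip_def mult.commute)
  also have "\<dots> = (\<Sum>b\<in>B. \<Sum>a\<in>A. \<Sum>a'\<in>A. psi x a y' b * cnj (psi x a' y' b) * (m a * cnj (m a')))"
    by (simp add: C cnj_sum sum_product ac_simps)
  also have "\<dots> = (\<Sum>a\<in>A. \<Sum>b\<in>B. \<Sum>a'\<in>A. psi x a y' b * cnj (psi x a' y' b) * (m a * cnj (m a')))"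
    by (rule sum.swap)
  also have "\<dots> = (\<Sum>a\<in>A. \<Sum>a'\<in>A. \<Sum>b\<in>B. psi x a y' b * cnj (psi x a' y' b) * (m a * cnj (m a')))"
    by (intro sum.cong refl sum.swap)
  also have "\<dots> = (\<Sum>a\<in>A. \<Sum>a'\<in>A. T x y' a a' * (m a * cnj (m a')))"
    by (simp add: T_def flip: sum_distrib_right)
  finally show ?thesis unfolding m_def by (metis Re_complex_of_real)
qed

lemma C_diag: "C x y y u = ap B (G x y) u"
  by (simp add: fun_eq_iff C_def ap_def G_def)

lemma C_zero:
  assumes "x \<in> X" "y \<in> Y" "y' \<in> Y" "\<not> (E x y \<and> E x y')" "b' \<in> B"
  shows "C x y' y u b' = 0"
  unfolding C_def using zero assms by (intro sum.neutral) (auto intro!: sum.neutral)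

text \<open>Klein's lower bound for \<open>R\<close> with the dephased state \<sigma> as reference;
  what has to be computed is how far \<open>R\<close> stretches each eigenvector of
  \<sigma>.\<close>

lemma kernel_entropy_R_lower:
  assumes G_ent: "(\<Sum>x\<in>X. \<Sum>y\<in>Y. kernel_entropy B (G x y)) = (\<Sum>y\<in>Y. kernel_entropy B (GY y)) + log 2 N"
    and T_ent: "(\<Sum>x\<in>X. \<Sum>y\<in>Y. kernel_entropy A (T x y)) = (\<Sum>x\<in>X. kernel_entropy A (TX x)) + 1"
  shows "kernel_entropy (Y \<times> B) R \<ge> (\<Sum>y\<in>Y. kernel_entropy B (GY y)) - 1 / (N * ln 2)"
proof -
  have "\<exists>f s. eigenbasis B (GY y) f s \<and> kernel_entropy B (GY y) = (\<Sum>k\<in>B. eta (s k))" for y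
    using kernel_entropy_witness[OF fin(4), of "GY y"] psd_kernels(3) unfolding psd_def by metis
  then obtain f s where fs: "\<And>y. eigenbasis B (GY y) (f y) (s y)"
    and kGY: "\<And>y. kernel_entropy B (GY y) = (\<Sum>k\<in>B. eta (s y k))"
    by metis
  note onb = eigenbasisD(1)[OF fs]
  have s0: "l \<in> B \<Longrightarrow> 0 \<le> s y l" for y l by (rule eigenbasis_psd_nonneg[OF fin(4) fs psd_kernels(3)])
  \<comment> \<open>Spectral data of \<sigma>: eigenvectors of the blocks \<open>GY y\<close>, each
    placed in its own block.\<close>
  define F where "F = (\<lambda>(y, l) (y', b). of_bool (y = y') * f y l b)"
  define S where "S = (\<lambda>(y, l). s y l)"
  have finYB: "finite (Y \<times> B)" using fin by simp
  have sumY: "(\<Sum>p\<in>Y \<times> B. of_bool (y = fst p) * h (snd p)) = (\<Sum>b\<in>B. h b :: complex)"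
    if "y \<in> Y" for y h
  proof -
    have "(\<Sum>p\<in>Y \<times> B. of_bool (y = fst p) * h (snd p)) = (\<Sum>y'\<in>Y. of_bool (y = y') * (\<Sum>b\<in>B. h b))"
      by (simp add: sum_distrib_left sum.cartesian_product case_prod_beta)
    then show ?thesis using fin that by (simp add: sum_of_bool_left)
  qed
  have onbF: "onb (Y \<times> B) F"
    unfolding onb_def
  proof (intro conjI ballI)
    fix p q assume pq: "p \<in> Y \<times> B" "q \<in> Y \<times> B"
    obtain y l y' l' where p: "p = (y, l)" "q = (y', l')" by (cases p, cases q) auto
    have "ip (Y \<times> B) (F p) (F q) =
        (\<Sum>r\<in>Y \<times> B. of_bool (y = fst r) * (of_bool (y = y') * (cnj (f y l (snd r)) * f y' l' (snd r))))"
      unfolding ip_def by (intro sum.cong) (auto simp: F_def p)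
    also have "\<dots> = of_bool (y = y') * ip B (f y l) (f y' l')"
      using pq by (subst sumY) (auto simp: p ip_def)
    finally show "ip (Y \<times> B) (F p) (F q) = of_bool (p = q)"
      using onbD(1)[OF onb, of l l' y] pq by (auto simp: p)
    have "(\<Sum>k\<in>Y \<times> B. F k p * cnj (F k q)) =
        (\<Sum>r\<in>Y \<times> B. of_bool (y = fst r) * (of_bool (y = y') * (f y (snd r) l * cnj (f y (snd r) l'))))"
      by (intro sum.cong) (auto simp: F_def p)
    also have "\<dots> = of_bool (y = y') * (\<Sum>k\<in>B. f y k l * cnj (f y k l'))"
      using pq by (subst sumY) (auto simp: p)
    finally show "(\<Sum>k\<in>Y \<times> B. F k p * cnj (F k q)) = of_bool (p = q)"
      using onbD(2)[OF onb, of l l' y] pq by (auto simp: p)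
  qed
  have apR: "ap (Y \<times> B) R (F (y, l)) (y', b') = (\<Sum>x\<in>X. C x y' y (f y l) b')"
    if "y \<in> Y" for y l y' b'
  proof -
    have "ap (Y \<times> B) R (F (y, l)) (y', b') = (\<Sum>p\<in>Y \<times> B. of_bool (y = fst p) * (R (y', b') (y, snd p) * f y l (snd p)))"
      unfolding ap_def by (intro sum.cong) (auto simp: F_def)
    also have "\<dots> = (\<Sum>b\<in>B. R (y', b') (y, b) * f y l b)" using that by (rule sumY)
    also have "\<dots> = (\<Sum>x\<in>X. C x y' y (f y l) b')"
      by (simp add: R_def RX_def C_def sum_distrib_right sum.swap[of _ X B])
    finally show ?thesis .
  qed
  have apR_diag: "(\<Sum>x\<in>X. C x y y (f y l) b) = of_real (s y l) * f y l b" if "l \<in> B" "b \<in> B" for y l b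
    using ap_sum_kernel[of B "GY y" "\<lambda>x. G x y" X b "f y l"] eigenbasis_eigenvector[OF fin(4) fs that(2,1)] that
    by (simp add: C_diag GY_def)
  \<comment> \<open>Off-diagonal blocks map a block vector out of its block, so \<open>R\<close> and
    \<sigma> have the same diagonal in this basis. Hence \<open>S\<close> serves both as
    \<open>s\<close> and as \<open>a\<close> in the bound.\<close>
  have a: "S p = Re (ip (Y \<times> B) (F p) (ap (Y \<times> B) R (F p)))" if p: "p \<in> Y \<times> B" for p
  proof -
    obtain y l where [simp]: "p = (y, l)" by (cases p)
    have "ip (Y \<times> B) (F p) (ap (Y \<times> B) R (F p)) =
        (\<Sum>q\<in>Y \<times> B. of_bool (y = fst q) * (cnj (f y l (snd q)) * (of_real (s y l) * f y l (snd q))))"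
      unfolding ip_def
    proof (intro sum.cong refl)
      fix q assume "q \<in> Y \<times> B"
      then show "cnj (F p q) * ap (Y \<times> B) R (F p) q =
          of_bool (y = fst q) * (cnj (f y l (snd q)) * (of_real (s y l) * f y l (snd q)))"
        using p apR_diag apR by (cases "y = fst q") (auto simp: F_def[THEN fun_cong, THEN fun_cong])
    qed
    also have "\<dots> = of_real (s y l) * ip B (f y l) (f y l)"
      using p by (subst sumY) (auto simp: ip_def sum_distrib_left ac_simps)
    finally show ?thesis using onbD(1)[OF onb, of l l y] p by (simp add: S_def)
  qed
  \<comment> \<open>Alice's independence allows \<open>y'\<close> to be replaced by \<open>y\<close>
    in the norm. What remains is the diagonal block \<open>G x y\<close>, which Bob's independence
    identifies with \<open>GY y\<close> divided by \<open>N\<close>.\<close>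
  have nsqC: "nsq B (C x y' y (f y l)) = (if E x y \<and> E x y' then (s y l)\<^sup>2 / N\<^sup>2 else 0)"
    if "x \<in> X" "y \<in> Y" "y' \<in> Y" "l \<in> B" for x y y' l
  proof (cases "E x y \<and> E x y'")
    case True
    have T: "T x y' a a' = T x y a a'" if "a \<in> A" "a' \<in> A" for a a'
      using T_independent[OF T_ent \<open>x \<in> X\<close>, of _ a a'] True \<open>y \<in> Y\<close> \<open>y' \<in> Y\<close> that by metis
    have "nsq B (C x y' y (f y l)) = nsq B (C x y y (f y l))"
      unfolding nsq_C using T by simp
    also have "\<dots> = nsq B (\<lambda>b. of_real (s y l / N) * f y l b)"
    proof (rule nsq_cong)
      fix b assume b: "b \<in> B"
      have "C x y y (f y l) b = ap B (\<lambda>b b'. GY y b b' / N) (f y l) b"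
        unfolding C_diag ap_def using G_independent[OF G_ent] that True b by (intro sum.cong) auto
      also have "\<dots> = ap B (GY y) (f y l) b / N"
        by (simp add: ap_def sum_divide_distrib)
      finally show "C x y y (f y l) b = of_real (s y l / N) * f y l b"
        using eigenbasis_eigenvector[OF fin(4) fs b that(4)] by simp
    qed
    also have "\<dots> = (s y l)\<^sup>2 / N\<^sup>2"
      using onb_nsq[OF onb that(4)]
      unfolding nsq_scale norm_of_real power2_abs by (simp add: power_divide)
    finally show ?thesis using True by simp
  next
    case False
    then show ?thesis
      unfolding if_not_P[OF False] nsq_def using C_zero[OF that(1-3) False] by simp
  qed
  have nsqR: "nsq (Y \<times> B) (ap (Y \<times> B) R (F p)) = (S p)\<^sup>2 * (1 + 1 / N)" if p: "p \<in> Y \<times> B" for p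
  proof -
    obtain y l where pyl [simp]: "p = (y, l)" by (cases p)
    have y: "y \<in> Y" and l: "l \<in> B" using p by auto
    let ?c = "\<lambda>y' b'. \<Sum>x\<in>X. C x y' y (f y l) b'"
    have "nsq (Y \<times> B) (ap (Y \<times> B) R (F p)) = (\<Sum>y'\<in>Y. nsq B (?c y'))"
      unfolding nsq_def sum.cartesian_product by (intro sum.cong) (auto simp: apR[OF y])
    also have "\<dots> = nsq B (?c y) + (\<Sum>y'\<in>Y - {y}. nsq B (?c y'))"
      by (rule sum.remove[OF fin(2) y])
    also have "nsq B (?c y) = (s y l)\<^sup>2"
    proof -
      have "nsq B (?c y) = nsq B (\<lambda>b. of_real (s y l) * f y l b)"
        by (intro nsq_cong apR_diag l)
      then show ?thesis using onb_nsq[OF onb l] by (simp add: nsq_scale)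
    qed
    \<comment> \<open>Contributions of different \<open>x\<close> to one block \<open>y'\<close>
      cannot interfere, since \<open>y\<close> and \<open>y'\<close> have at most one common
      neighbour.\<close>
    also have "(\<Sum>y'\<in>Y - {y}. nsq B (?c y')) = (\<Sum>y'\<in>Y - {y}. \<Sum>x\<in>X. nsq B (C x y' y (f y l)))"
    proof (intro sum.cong refl nsq_sum_at_most_one[where P="\<lambda>x. E x y \<and> E x _"])
      fix y' assume y': "y' \<in> Y - {y}"
      show "finite X" by (rule fin)
      show "x = x'" if "x \<in> X" "x' \<in> X" "E x y \<and> E x y'" "E x' y \<and> E x' y'" for x x'
        using no_4_cycle[of y y' x x'] that y y' by auto
      show "C x y' y (f y l) i = 0" if "x \<in> X" "\<not> (E x y \<and> E x y')" "i \<in> B" for x i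
        using C_zero[of x y y' i] that y y' by auto
    qed
    also have "\<dots> = (\<Sum>x\<in>X. \<Sum>y'\<in>Y - {y}. if E x y \<and> E x y' then (s y l)\<^sup>2 / N\<^sup>2 else 0)"
      using nsqC y l by (subst sum.swap) (auto intro!: sum.cong)
    also have "\<dots> = (\<Sum>x\<in>X. if E x y then (s y l)\<^sup>2 / N\<^sup>2 else 0)"
    proof (intro sum.cong refl)
      fix x assume x: "x \<in> X"
      show "(\<Sum>y'\<in>Y - {y}. if E x y \<and> E x y' then (s y l)\<^sup>2 / N\<^sup>2 else 0) = (if E x y then (s y l)\<^sup>2 / N\<^sup>2 else 0)"
      proof (cases "E x y")
        case True
        \<comment> \<open>A neighbour \<open>x\<close> of \<open>y\<close> has degree 2, so it leads
          to exactly one other block.\<close>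
        have "{y' \<in> Y - {y}. E x y'} = {y' \<in> Y. E x y'} - {y}" by auto
        then have "card {y' \<in> Y - {y}. E x y'} = 1"
          using deg_X[OF x] True y by simp
        then show ?thesis using True fin by (simp add: sum.If_cases Int_def conj_ac)
      qed simp
    qed
    also have "\<dots> = N * ((s y l)\<^sup>2 / N\<^sup>2)"
      using fin deg_Y[OF y] by (simp add: sum.If_cases Int_def)
    finally show ?thesis using Npos by (simp add: S_def field_simps power2_eq_square)
  qed
  have sumS: "(\<Sum>p\<in>Y \<times> B. S p) = 1"
  proof -
    have "(\<Sum>p\<in>Y \<times> B. S p) = (\<Sum>y\<in>Y. \<Sum>l\<in>B. s y l)"
      by (simp add: S_def sum.cartesian_product)
    then show ?thesis using eigenbasis_trace[OF fin(4) fs] trace_GY by simp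
  qed
  have "- (\<Sum>p\<in>Y \<times> B. S p * log 2 (S p))
       - ((\<Sum>p\<in>Y \<times> B. nsq (Y \<times> B) (ap (Y \<times> B) R (F p)) / S p) - (\<Sum>p\<in>Y \<times> B. S p)) / ln 2 \<le> kernel_entropy (Y \<times> B) R"
    by (rule kernel_entropy_lower[OF finYB psd_kernels(6) onbF _ _ a]) (use s0 in \<open>auto simp: S_def\<close>)
  \<comment> \<open>At \<open>S p = 0\<close> both summands vanish, again by
    \<open>x / 0 = 0\<close>.\<close>
  also have "(\<Sum>p\<in>Y \<times> B. nsq (Y \<times> B) (ap (Y \<times> B) R (F p)) / S p) = (\<Sum>p\<in>Y \<times> B. S p * (1 + 1 / N))"
    by (intro sum.cong refl) (simp add: nsqR power2_eq_square)
  also have "\<dots> = 1 + 1 / N" unfolding sum_distrib_right[symmetric] sumS by simp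
  also have "(\<Sum>p\<in>Y \<times> B. S p * log 2 (S p)) = - (\<Sum>y\<in>Y. kernel_entropy B (GY y))"
  proof -
    have "(\<Sum>p\<in>Y \<times> B. S p * log 2 (S p)) = (\<Sum>p\<in>Y \<times> B. - eta (S p))"
    proof (intro sum.cong refl)
      fix p assume "p \<in> Y \<times> B"
      then have "0 \<le> S p" using s0 by (auto simp: S_def)
      then show "S p * log 2 (S p) = - eta (S p)" by (cases "S p = 0") (auto simp: eta_def)
    qed
    then show ?thesis by (simp add: kGY S_def sum_negf sum.cartesian_product case_prod_beta)
  qed
  finally show ?thesis by (simp add: sumS)
qed

text \<open>Purity links the two sides: the entropies of the \<open>RX x\<close> add up to those of
  the \<open>TX x\<close>, which are those of the \<open>T x y\<close> minus 1, hence those of the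
  \<open>G x y\<close> minus 1, hence those of the \<open>GY y\<close> plus \<open>log 2 N\<close>
  minus 1.\<close>

lemma kernel_entropy_gap:
  assumes "(\<Sum>x\<in>X. \<Sum>y\<in>Y. kernel_entropy B (G x y)) = (\<Sum>y\<in>Y. kernel_entropy B (GY y)) + log 2 N"
    and "(\<Sum>x\<in>X. \<Sum>y\<in>Y. kernel_entropy A (T x y)) = (\<Sum>x\<in>X. kernel_entropy A (TX x)) + 1"
  shows "kernel_entropy (Y \<times> B) R - (\<Sum>x\<in>X. kernel_entropy (Y \<times> B) (RX x)) \<ge> 1 - log 2 N - 1 / (N * ln 2)"
  using kernel_entropy_R_lower[OF assms] assms by (simp add: kernel_entropy_G_T kernel_entropy_RX_TX)

end

section \<open>Reduced states as block kernels\<close>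

definition enc :: "(nat \<Rightarrow> nat) \<Rightarrow> nat \<Rightarrow> nat \<Rightarrow> nat \<Rightarrow> nat \<Rightarrow> nat" where
  "enc d a a' b b' = ((a * d 1 + a') * d 2 + b) * d 3 + b'"

lemma comp_enc:
  assumes "a' < d 1" "b < d 2" "b' < d 3"
  shows "comp d (enc d a a' b b') 0 = a" "comp d (enc d a a' b b') (Suc 0) = a'"
    "comp d (enc d a a' b b') 2 = b" "comp d (enc d a a' b b') 3 = b'"
  using assms by (simp_all add: comp_def enc_def div_mult2_eq)

lemma enc_less:
  assumes "a < d 0" "a' < d 1" "b < d 2" "b' < d 3"
  shows "enc d a a' b b' < dimtot d"
proof -
  have less: "x * m + y < k * m" if "x < k" "y < m" for x y k m :: nat
  proof -
    have "x * m + y < Suc x * m" using that by simp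
    also have "\<dots> \<le> k * m" using that by (intro mult_le_mono) auto
    finally show ?thesis .
  qed
  show ?thesis unfolding enc_def dimtot_def by (intro less assms)
qed

lemma comp_less:
  assumes "i < dimtot d"
  shows "comp d i 0 < d 0" "comp d i (Suc 0) < d (Suc 0)" "comp d i 2 < d 2" "comp d i 3 < d 3"
proof -
  have "0 < dimtot d" using assms by simp
  then have "0 < d 1" "0 < d 2" "0 < d 3" by (auto simp: dimtot_def)
  moreover have "i < d 0 * (d 3 * d 2 * d 1)" using assms by (simp add: dimtot_def ac_simps)
  ultimately show "comp d i 0 < d 0" "comp d i (Suc 0) < d (Suc 0)" "comp d i 2 < d 2" "comp d i 3 < d 3"
    by (simp_all add: comp_def less_mult_imp_div_less)
qed

lemma enc_comp: "enc d (comp d i 0) (comp d i (Suc 0)) (comp d i 2) (comp d i 3) = i"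
  by (simp add: enc_def comp_def div_mult2_eq)

lemma enc_eqI:
  "comp d i 0 = a \<Longrightarrow> comp d i (Suc 0) = a' \<Longrightarrow> comp d i 2 = b \<Longrightarrow> comp d i 3 = b' \<Longrightarrow> enc d a a' b b' = i"
  by (metis enc_comp)

lemma comp_eqI:
  "comp d i 0 = comp d k 0 \<Longrightarrow> comp d i (Suc 0) = comp d k (Suc 0) \<Longrightarrow> comp d i 2 = comp d k 2 \<Longrightarrow>
    comp d i 3 = comp d k 3 \<Longrightarrow> i = k"
  by (metis enc_comp)

lemma all_less_4: "(\<forall>j<4. P j) \<longleftrightarrow> P 0 \<and> P (Suc 0) \<and> P 2 \<and> P (3::nat)"
  by (simp add: numeral_eq_Suc All_less_Suc conj_ac)

text \<open>Together with \<open>fill\<close> this lets one fourfold sum describe every choice of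
  modes: a traced register runs through its whole range, any other contributes a dummy index 0 and
  takes its value from the fixed basis index.\<close>

definition traced :: "(nat \<Rightarrow> nat) \<Rightarrow> (nat \<Rightarrow> regmode) \<Rightarrow> nat \<Rightarrow> nat set" where
  "traced d md j = (if md j = Tr then {..<d j} else {0})"

definition fill :: "(nat \<Rightarrow> nat) \<Rightarrow> (nat \<Rightarrow> regmode) \<Rightarrow> nat \<Rightarrow> nat \<Rightarrow> nat \<Rightarrow> nat" where
  "fill d md i j t = (if md j = Tr then t else comp d i j)"

text \<open>An admissible pair of basis indices is determined by the values of its traced registers,
  which both members share; \<open>e\<close> rebuilds the two members from these values and
  \<open>z\<close> reads the values off.\<close>

lemma reduced_sum:
  assumes i: "i < dimtot d" and k: "k < dimtot d"
  shows "(\<Sum>(m, m') \<in> {(m, m'). m < dimtot d \<and> m' < dimtot d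
              \<and> (\<forall>j<4. md j = Tr \<longrightarrow> comp d m j = comp d m' j)
              \<and> (\<forall>j<4. md j \<noteq> Tr \<longrightarrow> comp d m j = comp d i j \<and> comp d m' j = comp d k j)}.
            amp psi d m * cnj (amp psi d m')) =
    (\<Sum>t0\<in>traced d md 0. \<Sum>t1\<in>traced d md 1. \<Sum>t2\<in>traced d md 2. \<Sum>t3\<in>traced d md 3.
       psi (fill d md i 0 t0) (fill d md i 1 t1) (fill d md i 2 t2) (fill d md i 3 t3) *
       cnj (psi (fill d md k 0 t0) (fill d md k 1 t1) (fill d md k 2 t2) (fill d md k 3 t3)))"
    (is "?L = ?R")
proof -
  define T where "T = traced d md 0 \<times> traced d md 1 \<times> traced d md 2 \<times> traced d md 3"
  define e where "e i = (\<lambda>(t0, t1, t2, t3). enc d (fill d md i 0 t0) (fill d md i 1 t1) (fill d md i 2 t2) (fill d md i 3 t3))" for i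
  define z where "z m j = (if md j = Tr then comp d m j else 0)" for m j
  have fill_less: "fill d md i 0 t0 < d 0 \<and> fill d md i 1 t1 < d 1 \<and> fill d md i 2 t2 < d 2 \<and> fill d md i 3 t3 < d 3"
    if "i < dimtot d" "(t0, t1, t2, t3) \<in> T" for i t0 t1 t2 t3
    using that comp_less[OF that(1)] by (auto simp: T_def fill_def traced_def split: if_splits)
  have comp_e: "comp d (e i t) 0 = fill d md i 0 (fst t)" "comp d (e i t) (Suc 0) = fill d md i 1 (fst (snd t))"
     "comp d (e i t) 2 = fill d md i 2 (fst (snd (snd t)))" "comp d (e i t) 3 = fill d md i 3 (snd (snd (snd t)))"
     "e i t < dimtot d"
    if "i < dimtot d" "t \<in> T" for i t
    using fill_less[OF that(1), of "fst t" "fst (snd t)" "fst (snd (snd t))" "snd (snd (snd t))"] that(2)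
    by (auto simp: e_def comp_enc enc_less case_prod_beta)
  have T_z: "z (e i t) 0 = fst t" "z (e i t) (Suc 0) = fst (snd t)" "z (e i t) 2 = fst (snd (snd t))"
      "z (e i t) 3 = snd (snd (snd t))" if "t \<in> T" for t
    using that by (auto simp: z_def comp_e[OF i that] fill_def T_def traced_def split: if_splits)
  have "?R = (\<Sum>t\<in>T. psi (fill d md i 0 (fst t)) (fill d md i 1 (fst (snd t)))
      (fill d md i 2 (fst (snd (snd t)))) (fill d md i 3 (snd (snd (snd t)))) *
    cnj (psi (fill d md k 0 (fst t)) (fill d md k 1 (fst (snd t)))
      (fill d md k 2 (fst (snd (snd t)))) (fill d md k 3 (snd (snd (snd t))))))"
    by (simp add: T_def sum.cartesian_product case_prod_beta)
  also have "\<dots> = (\<Sum>t\<in>T. amp psi d (e i t) * cnj (amp psi d (e k t)))"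
    by (intro sum.cong refl) (simp add: amp_def comp_e[OF i] comp_e[OF k])
  also have "\<dots> = ?L"
  proof (rule sum.reindex_bij_witness[where j="\<lambda>t. (e i t, e k t)"
        and i="\<lambda>(m, m'). (z m 0, z m (Suc 0), z m 2, z m 3)"], goal_cases)
    case (1 t)
    then show ?case by (simp add: T_z)
  next
    case (2 t)
    then show ?case
      by (auto simp: all_less_4 comp_e[OF i] comp_e[OF k] fill_def)
  next
    case (3 p)
    obtain m m' where p: "p = (m, m')" by (cases p)
    have zT: "(z m 0, z m (Suc 0), z m 2, z m 3) \<in> T"
      using 3 comp_less[of m d] by (auto simp: T_def traced_def z_def p)
    have fz: "fill d md i j (z m j) = comp d m j" "fill d md k j (z m j) = comp d m' j" if "j < 4" for j
      using 3 that unfolding p by (cases "md j = Tr"; simp add: fill_def z_def)+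
    have "e i (z m 0, z m (Suc 0), z m 2, z m 3) = m"
      by (rule comp_eqI[where d=d]) (simp_all add: comp_e[OF i zT] fz)
    moreover have "e k (z m 0, z m (Suc 0), z m 2, z m 3) = m'"
      by (rule comp_eqI[where d=d]) (simp_all add: comp_e[OF k zT] fz)
    ultimately show ?case by (simp add: p)
  next
    case (4 p)
    then show ?case using comp_less[of "fst p" d] by (auto simp: T_def traced_def z_def)
  next
    case (5 t)
    then show ?case by simp
  qed
  finally show ?thesis ..
qed

text \<open>The interface to the concrete states. \<open>D\<close> collects the indices with traced
  registers at their placeholder 0; it suffices that \<open>mu\<close> separates measured outcomes
  and that \<open>mu\<close> and \<open>q\<close> together enumerate \<open>D\<close>.\<close>

lemma ent_block:
  fixes d :: "nat \<Rightarrow> nat" and md :: "nat \<Rightarrow> regmode" and q :: "nat \<Rightarrow> 'q" and mu :: "nat \<Rightarrow> 'm"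
  defines "D \<equiv> {i. i < dimtot d \<and> (\<forall>j<4. md j = Tr \<longrightarrow> comp d i j = 0)}"
  assumes bij: "bij_betw (\<lambda>i. (mu i, q i)) D (M \<times> Q)" and fin: "finite M" "finite Q"
    and psd: "\<And>m. m \<in> M \<Longrightarrow> psd Q (G m)"
    and mu: "\<And>i k. i \<in> D \<Longrightarrow> k \<in> D \<Longrightarrow> (\<forall>j<4. md j = Meas \<longrightarrow> comp d i j = comp d k j) \<longleftrightarrow> mu i = mu k"
    and G: "\<And>i k. i \<in> D \<Longrightarrow> k \<in> D \<Longrightarrow> mu i = mu k \<Longrightarrow>
      (\<Sum>t0\<in>traced d md 0. \<Sum>t1\<in>traced d md 1. \<Sum>t2\<in>traced d md 2. \<Sum>t3\<in>traced d md 3.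
       psi (fill d md i 0 t0) (fill d md i 1 t1) (fill d md i 2 t2) (fill d md i 3 t3) *
       cnj (psi (fill d md k 0 t0) (fill d md k 1 t1) (fill d md k 2 t2) (fill d md k 3 t3))) =
       G (mu i) (q i) (q k)"
  shows "ent psi d md = (\<Sum>m\<in>M. kernel_entropy Q (G m))"
proof -
  define R where "R i k = reduced psi d md $$ (i, k)" for i k
  have D: "D \<subseteq> {..<dimtot d}" by (auto simp: D_def)
  have R: "R i k = (if i \<in> D \<and> k \<in> D \<and> mu i = mu k then G (mu i) (q i) (q k) else 0)"
    if ik: "i \<in> {..<dimtot d}" "k \<in> {..<dimtot d}" for i k
  proof (cases "i \<in> D \<and> k \<in> D \<and> mu i = mu k")
    case True
    then have "R i k = (\<Sum>(m, m') \<in> {(m, m'). m < dimtot d \<and> m' < dimtot d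
              \<and> (\<forall>j<4. md j = Tr \<longrightarrow> comp d m j = comp d m' j)
              \<and> (\<forall>j<4. md j \<noteq> Tr \<longrightarrow> comp d m j = comp d i j \<and> comp d m' j = comp d k j)}.
            amp psi d m * cnj (amp psi d m'))"
      using ik mu[of i k] unfolding R_def reduced_def by (auto simp: D_def)
    also have "\<dots> = G (mu i) (q i) (q k)"
      unfolding reduced_sum[OF ik[unfolded lessThan_iff]] using True by (intro G) auto
    finally show ?thesis using True by simp
  next
    case False
    then show ?thesis
      using ik mu[of i k] unfolding R_def reduced_def by (auto simp: D_def)
  qed
  note block = kernel_entropy_block[where S="{..<dimtot d}" and R=R, OF _ D bij fin psd R]
  have "reduced psi d md = mat (dimtot d) (dimtot d) (\<lambda>(i, j). R i j)"
    by (rule eq_matI) (auto simp: R_def reduced_def)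
  then have "ent psi d md = kernel_entropy {..<dimtot d} R"
    using vn_entropy_eq_kernel_entropy[of "dimtot d" R] block(1) by (simp add: ent_def psd_def)
  then show ?thesis using block(2) by simp
qed

text \<open>A purely classical state has blocks of size one; \<open>()\<close> stands for the
  trivial quantum index.\<close>

lemma kernel_entropy_unit:
  assumes "G () () = of_real p" "0 \<le> p"
  shows "psd {()} G" "kernel_entropy {()} G = eta p"
proof -
  have dec: "orth_dec {()} G {()} (\<lambda>_ _. of_real (sqrt p))"
    using assms by (simp add: orth_dec_def flip: of_real_mult)
  show "psd {()} G" by (rule orth_dec_psd[OF dec])
  show "kernel_entropy {()} G = eta p" using kernel_entropy_orth_dec[OF _ dec] assms by (simp add: nsq_def)
qed

section \<open>Entropies of the eight register combinations\<close>

context bipartite_state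
begin

context
  fixes d :: "nat \<Rightarrow> nat"
  assumes X: "X = {..<d 0}" and A: "A = {..<d 1}" and Y: "Y = {..<d 2}" and B: "B = {..<d 3}"
    and pos: "0 < d 0" "0 < d 1" "0 < d 2" "0 < d 3"
begin

lemmas mode_simps = modes_def all_less_4 traced_def fill_def comp_enc comp_less enc_less

lemma ent_X: "ent psi d (modes {0} {}) = (\<Sum>x\<in>X. eta (\<Sum>y\<in>Y. \<Sum>a\<in>A. \<Sum>b\<in>B. (cmod (psi x a y b))\<^sup>2))"
proof -
  define p where "p x = (\<Sum>y\<in>Y. \<Sum>a\<in>A. \<Sum>b\<in>B. (cmod (psi x a y b))\<^sup>2)" for x
  have p: "(\<Sum>a\<in>A. \<Sum>y\<in>Y. \<Sum>b\<in>B. psi x a y b * cnj (psi x a y b)) = of_real (p x)" for x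
    by (subst sum.swap) (simp add: p_def complex_norm_square flip: of_real_power)
  have p0: "0 \<le> p x" for x by (simp add: p_def sum_nonneg)
  have "ent psi d (modes {0} {}) = (\<Sum>x\<in>X. kernel_entropy {()} (\<lambda>_ _. complex_of_real (p x)))"
  proof (rule ent_block[where mu="\<lambda>i. comp d i 0" and q="\<lambda>_. ()"])
    show "bij_betw (\<lambda>i. (comp d i 0, ()))
       {i. i < dimtot d \<and> (\<forall>j<4. modes {0} {} j = Tr \<longrightarrow> comp d i j = 0)} (X \<times> {()})"
      by (rule bij_betw_byWitness[where f'="\<lambda>(x, _). enc d x 0 0 0"])
        (use pos in \<open>auto simp: X mode_simps intro: enc_eqI\<close>)
  qed (use pos kernel_entropy_unit(1)[OF _ p0] in \<open>auto simp: X A[unfolded One_nat_def, symmetric] Y[symmetric] B[symmetric] mode_simps p[symmetric]\<close>)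
  then show ?thesis using kernel_entropy_unit(2)[OF _ p0] by (simp add: p_def)
qed

lemma ent_Y: "ent psi d (modes {2} {}) = (\<Sum>y\<in>Y. eta (\<Sum>x\<in>X. \<Sum>a\<in>A. \<Sum>b\<in>B. (cmod (psi x a y b))\<^sup>2))"
proof -
  define p where "p y = (\<Sum>x\<in>X. \<Sum>a\<in>A. \<Sum>b\<in>B. (cmod (psi x a y b))\<^sup>2)" for y
  have p: "(\<Sum>x\<in>X. \<Sum>a\<in>A. \<Sum>b\<in>B. psi x a y b * cnj (psi x a y b)) = of_real (p y)" for y
    by (simp add: p_def complex_norm_square flip: of_real_power)
  have p0: "0 \<le> p x" for x by (simp add: p_def sum_nonneg)
  have "ent psi d (modes {2} {}) = (\<Sum>x\<in>Y. kernel_entropy {()} (\<lambda>_ _. complex_of_real (p x)))"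
  proof (rule ent_block[where mu="\<lambda>i. comp d i 2" and q="\<lambda>_. ()"])
    show "bij_betw (\<lambda>i. (comp d i 2, ()))
       {i. i < dimtot d \<and> (\<forall>j<4. modes {2} {} j = Tr \<longrightarrow> comp d i j = 0)} (Y \<times> {()})"
      by (rule bij_betw_byWitness[where f'="\<lambda>(y, _). enc d 0 0 y 0"])
        (use pos in \<open>auto simp: Y mode_simps intro: enc_eqI\<close>)
  qed (use pos kernel_entropy_unit(1)[OF _ p0] in \<open>auto simp: Y X[symmetric] A[unfolded One_nat_def, symmetric] B[symmetric] mode_simps p[symmetric]\<close>)
  then show ?thesis using kernel_entropy_unit(2)[OF _ p0] by (simp add: p_def)
qed

lemma ent_YB: "ent psi d (modes {2} {3}) = (\<Sum>y\<in>Y. kernel_entropy B (GY y))"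
proof (rule ent_block[where mu="\<lambda>i. comp d i 2" and q="\<lambda>i. comp d i 3"])
  show "bij_betw (\<lambda>i. (comp d i 2, comp d i 3))
     {i. i < dimtot d \<and> (\<forall>j<4. modes {2} {3} j = Tr \<longrightarrow> comp d i j = 0)} (Y \<times> B)"
    by (rule bij_betw_byWitness[where f'="\<lambda>(y, b). enc d 0 0 y b"])
      (use pos in \<open>auto simp: Y B mode_simps intro: enc_eqI\<close>)
qed (use pos in \<open>auto simp: fin psd_kernels mode_simps GY_def G_def X[symmetric] A[unfolded One_nat_def, symmetric]\<close>)

lemma ent_XYB: "ent psi d (modes {0, 2} {3}) = (\<Sum>x\<in>X. \<Sum>y\<in>Y. kernel_entropy B (G x y))"
proof -
  have "ent psi d (modes {0, 2} {3}) = (\<Sum>m\<in>X \<times> Y. kernel_entropy B (case_prod G m))"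
  proof (rule ent_block[where mu="\<lambda>i. (comp d i 0, comp d i 2)" and q="\<lambda>i. comp d i 3"])
    show "bij_betw (\<lambda>i. ((comp d i 0, comp d i 2), comp d i 3))
       {i. i < dimtot d \<and> (\<forall>j<4. modes {0, 2} {3} j = Tr \<longrightarrow> comp d i j = 0)} ((X \<times> Y) \<times> B)"
      by (rule bij_betw_byWitness[where f'="\<lambda>((x, y), b). enc d x 0 y b"])
        (use pos in \<open>auto simp: X Y B mode_simps intro: enc_eqI\<close>)
  qed (use pos in \<open>auto simp: fin psd_kernels mode_simps G_def A[unfolded One_nat_def, symmetric]\<close>)
  then show ?thesis by (simp add: sum.cartesian_product case_prod_beta)
qed

lemma ent_XA: "ent psi d (modes {0} {1}) = (\<Sum>x\<in>X. kernel_entropy A (TX x))"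
proof (rule ent_block[where mu="\<lambda>i. comp d i 0" and q="\<lambda>i. comp d i (Suc 0)"])
  show "bij_betw (\<lambda>i. (comp d i 0, comp d i (Suc 0)))
     {i. i < dimtot d \<and> (\<forall>j<4. modes {0} {1} j = Tr \<longrightarrow> comp d i j = 0)} (X \<times> A)"
    by (rule bij_betw_byWitness[where f'="\<lambda>(x, a). enc d x a 0 0"])
      (use pos in \<open>auto simp: X A mode_simps intro: enc_eqI\<close>)
qed (use pos in \<open>auto simp: fin psd_kernels mode_simps TX_def T_def Y[symmetric] B[symmetric]\<close>)

lemma ent_XYA: "ent psi d (modes {0, 2} {1}) = (\<Sum>x\<in>X. \<Sum>y\<in>Y. kernel_entropy A (T x y))"
proof -
  have "ent psi d (modes {0, 2} {1}) = (\<Sum>m\<in>X \<times> Y. kernel_entropy A (case_prod T m))"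
  proof (rule ent_block[where mu="\<lambda>i. (comp d i 0, comp d i 2)" and q="\<lambda>i. comp d i (Suc 0)"])
    show "bij_betw (\<lambda>i. ((comp d i 0, comp d i 2), comp d i (Suc 0)))
       {i. i < dimtot d \<and> (\<forall>j<4. modes {0, 2} {1} j = Tr \<longrightarrow> comp d i j = 0)} ((X \<times> Y) \<times> A)"
      by (rule bij_betw_byWitness[where f'="\<lambda>((x, y), a). enc d x a y 0"])
        (use pos in \<open>auto simp: X Y A mode_simps intro: enc_eqI\<close>)
  qed (use pos in \<open>auto simp: fin psd_kernels mode_simps T_def B[symmetric]\<close>)
  then show ?thesis by (simp add: sum.cartesian_product case_prod_beta)
qed

text \<open>With no register measured there is a single block, labelled \<open>()\<close>.\<close>

lemma ent_BB: "ent psi d (modes {} {2, 3}) = kernel_entropy (Y \<times> B) R"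
proof -
  have "ent psi d (modes {} {2, 3}) = (\<Sum>m\<in>{()}. kernel_entropy (Y \<times> B) R)"
  proof (rule ent_block[where mu="\<lambda>_. ()" and q="\<lambda>i. (comp d i 2, comp d i 3)"])
    show "bij_betw (\<lambda>i. ((), comp d i 2, comp d i 3))
       {i. i < dimtot d \<and> (\<forall>j<4. modes {} {2, 3} j = Tr \<longrightarrow> comp d i j = 0)} ({()} \<times> Y \<times> B)"
      by (rule bij_betw_byWitness[where f'="\<lambda>(_, y, b). enc d 0 0 y b"])
        (use pos in \<open>auto simp: Y B mode_simps intro: enc_eqI\<close>)
  qed (use pos in \<open>auto simp: fin psd_kernels mode_simps R_def RX_def X[symmetric] A[unfolded One_nat_def, symmetric]\<close>)
  then show ?thesis by simp
qed

lemma ent_XBB: "ent psi d (modes {0} {2, 3}) = (\<Sum>x\<in>X. kernel_entropy (Y \<times> B) (RX x))"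
proof (rule ent_block[where mu="\<lambda>i. comp d i 0" and q="\<lambda>i. (comp d i 2, comp d i 3)"])
  show "bij_betw (\<lambda>i. (comp d i 0, comp d i 2, comp d i 3))
     {i. i < dimtot d \<and> (\<forall>j<4. modes {0} {2, 3} j = Tr \<longrightarrow> comp d i j = 0)} (X \<times> Y \<times> B)"
    by (rule bij_betw_byWitness[where f'="\<lambda>(x, y, b). enc d x 0 y b"])
      (use pos in \<open>auto simp: X Y B mode_simps intro: enc_eqI\<close>)
qed (use pos in \<open>auto simp: fin psd_kernels mode_simps RX_def A[unfolded One_nat_def, symmetric]\<close>)

end

end

section \<open>Oblivious transfer\<close>

definition ot_rel :: "nat \<Rightarrow> nat \<Rightarrow> nat \<Rightarrow> bool" where
  "ot_rel r x y \<longleftrightarrow> y div 2 = (if y mod 2 = 0 then x mod 2^r else x div 2^r)"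

lemma P_OT_eq: "x < nX r \<Longrightarrow> y < nY r \<Longrightarrow> P_OT r x y = (if ot_rel r x y then 1 / 2^(2*r+1) else 0)"
  unfolding P_OT_def ot_rel_def nX_def nY_def by simp

lemma nX_eq: "nX r = 2^r * 2^r"
  by (simp only: nX_def mult_2 power_add)

lemma nY_eq: "nY r = 2 * 2^r"
  by (simp add: nY_def)

lemma ot_deg_X:
  assumes "x < nX r"
  shows "card {y \<in> {..<nY r}. ot_rel r x y} = 2"
proof -
  have k: "x div 2^r < 2^r" using assms by (simp add: nX_eq less_mult_imp_div_less)
  have "{y \<in> {..<nY r}. ot_rel r x y} = {2 * (x mod 2^r), 2 * (x div 2^r) + 1}"
  proof (rule Set.set_eqI)
    fix y
    have m: "x mod 2^r < 2^r" by simp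
    have "y < 2 * n \<and> y div 2 = (if y mod 2 = 0 then m else k) \<longleftrightarrow> y = 2 * m \<or> y = 2 * k + 1"
      if "m < n" "k < n" for m k n :: nat
    proof (cases "even y")
      case True
      then obtain q where "y = 2 * q" by (elim evenE)
      moreover have "2 * q \<noteq> 2 * k + 1" by presburger
      ultimately show ?thesis using that by auto
    next
      case False
      then obtain q where "y = 2 * q + 1" by (elim oddE)
      moreover have "2 * q + 1 \<noteq> 2 * m" by presburger
      ultimately show ?thesis using that by auto
    qed
    from this[OF m k]
    show "y \<in> {y \<in> {..<nY r}. ot_rel r x y} \<longleftrightarrow> y \<in> {2 * (x mod 2^r), 2 * (x div 2^r) + 1}"
      by (simp add: ot_rel_def nY_eq)
  qed
  moreover have "2 * m \<noteq> 2 * k + 1" for m k :: nat by presburger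
  ultimately show ?thesis by simp
qed

text \<open>The choice bit decides which of Alice's strings is fixed by \<open>y\<close>; the other
  one is free and has \<open>2^r\<close> values.\<close>

lemma ot_deg_Y:
  assumes "y < nY r"
  shows "card {x \<in> {..<nX r}. ot_rel r x y} = 2^r"
proof -
  define n :: nat where "n = 2^r"
  have y: "y div 2 < n" using assms by (simp add: nY_eq n_def)
  show ?thesis
  proof (cases "y mod 2 = 0")
    case True
    have "{x \<in> {..<nX r}. ot_rel r x y} = (\<lambda>t. t * n + y div 2) ` {..<n}"
    proof (intro equalityI subsetI)
      fix x assume "x \<in> {x \<in> {..<nX r}. ot_rel r x y}"
      then have "x < n * n" "y div 2 = x mod n" using True by (auto simp: ot_rel_def nX_eq n_def)
      then have "x = x div n * n + y div 2" "x div n < n" by (auto simp: less_mult_imp_div_less)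
      then show "x \<in> (\<lambda>t. t * n + y div 2) ` {..<n}" by blast
    next
      fix x assume "x \<in> (\<lambda>t. t * n + y div 2) ` {..<n}"
      then obtain t where t: "t < n" "x = t * n + y div 2" by auto
      have "x < Suc t * n" using t y by simp
      also have "\<dots> \<le> n * n" using t by (intro mult_le_mono) auto
      finally show "x \<in> {x \<in> {..<nX r}. ot_rel r x y}"
        using True t y by (auto simp: ot_rel_def nX_eq simp flip: n_def)
    qed
    moreover have "inj_on (\<lambda>t. t * n + y div 2) {..<n}" using y by (auto simp: inj_on_def)
    ultimately show ?thesis by (simp add: card_image n_def)
  next
    case False
    have "{x \<in> {..<nX r}. ot_rel r x y} = (\<lambda>t. (y div 2) * n + t) ` {..<n}"
    proof (intro equalityI subsetI)
      fix x assume "x \<in> {x \<in> {..<nX r}. ot_rel r x y}"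
      then have "x < n * n" "y div 2 = x div n" using False by (auto simp: ot_rel_def nX_eq n_def)
      then have "x = (y div 2) * n + x mod n" "x mod n < n" using y by auto
      then show "x \<in> (\<lambda>t. (y div 2) * n + t) ` {..<n}" by blast
    next
      fix x assume "x \<in> (\<lambda>t. (y div 2) * n + t) ` {..<n}"
      then obtain t where t: "t < n" "x = (y div 2) * n + t" by auto
      have "x < Suc (y div 2) * n" using t y by simp
      also have "\<dots> \<le> n * n" using y by (intro mult_le_mono) auto
      finally show "x \<in> {x \<in> {..<nX r}. ot_rel r x y}"
        using False t y by (auto simp: ot_rel_def nX_eq simp flip: n_def)
    qed
    moreover have "inj_on (\<lambda>t. (y div 2) * n + t) {..<n}" by (auto simp: inj_on_def)
    ultimately show ?thesis by (simp add: card_image n_def)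
  qed
qed

text \<open>Two different outputs compatible with the same \<open>x\<close> must have different
  choice bits, so together they determine both strings.\<close>

lemma ot_no_4_cycle:
  assumes "y \<noteq> y'" "ot_rel r x y" "ot_rel r x y'" "ot_rel r x' y" "ot_rel r x' y'"
  shows "x = x'"
proof -
  have "y mod 2 \<noteq> y' mod 2"
  proof
    assume "y mod 2 = y' mod 2"
    moreover from this have "y div 2 = y' div 2" using assms(2,3) by (simp add: ot_rel_def)
    ultimately show False using assms(1) by (metis div_mult_mod_eq)
  qed
  then have "x mod 2^r = x' mod 2^r \<and> x div 2^r = x' div 2^r"
    using assms(2-5) by (auto simp: ot_rel_def split: if_splits)
  then show ?thesis by (metis div_mult_mod_eq)
qed

text \<open>General in \<open>f\<close> because it is used with the identity for the marginal of
  \<open>X\<close> and with \<open>eta\<close> for the joint entropy.\<close>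

lemma sum_P_OT_row: "x < nX r \<Longrightarrow> (\<Sum>y<nY r. f (P_OT r x y)) = 2 * f (1 / 2^(2*r+1))" if "f 0 = 0" for f :: "real \<Rightarrow> real"
proof -
  assume x: "x < nX r"
  have card: "card {y. y < nY r \<and> ot_rel r x y} = 2" using ot_deg_X[OF x] by simp
  have "(\<Sum>y<nY r. f (P_OT r x y)) = (\<Sum>y<nY r. if ot_rel r x y then f (1 / 2^(2*r+1)) else 0)"
    using x that by (intro sum.cong) (auto simp: P_OT_eq)
  also have "\<dots> = 2 * f (1 / 2^(2*r+1))"
    by (simp only: sum.If_cases finite_lessThan) (simp add: Int_def card)
  finally show ?thesis .
qed

lemma sum_P_OT_col:
  assumes "y < nY r"
  shows "(\<Sum>x<nX r. P_OT r x y) = 1 / 2^(r+1)"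
proof -
  have "(\<Sum>x<nX r. P_OT r x y) = (\<Sum>x<nX r. if ot_rel r x y then 1 / 2^(2*r+1) else 0)"
    using assms by (intro sum.cong) (auto simp: P_OT_eq)
  also have "\<dots> = 2^r / 2^(2*r+1)"
    using ot_deg_Y[OF assms] by (simp only: sum.If_cases finite_lessThan) (simp add: Int_def)
  also have "(2::real)^(2*r+1) = 2^r * 2^(r+1)"
    by (simp only: power_add[symmetric] mult_2 add.assoc)
  finally show ?thesis by simp
qed

lemma eta_pow: "eta (1 / 2^k) = k / 2^k"
proof -
  have "\<not> (2::real) ^ k \<le> 0" by (simp add: not_le)
  then show ?thesis by (simp add: eta_def log_divide log_nat_power)
qed

lemma sum_div_mod:
  fixes f :: "nat \<Rightarrow> nat \<Rightarrow> 'a :: comm_monoid_add"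
  shows "(\<Sum>z<a * b. f (z div b) (z mod b)) = (\<Sum>x<a. \<Sum>y<b. f x y)"
proof -
  have "(\<Sum>z<a * b. f (z div b) (z mod b)) = (\<Sum>x<a. \<Sum>z\<in>{x * b..<x * b + b}. f (z div b) (z mod b))"
    by (rule sum.nat_group[symmetric])
  also have "\<dots> = (\<Sum>x<a. \<Sum>y<b. f x y)"
  proof (rule sum.cong[OF refl])
    fix x
    have "(\<Sum>z\<in>{x * b..<x * b + b}. f (z div b) (z mod b)) = (\<Sum>y\<in>{0..<b}. f ((y + x * b) div b) ((y + x * b) mod b))"
      using sum.shift_bounds_nat_ivl[of "\<lambda>z. f (z div b) (z mod b)" 0 "x * b" b] by (simp add: add.commute)
    then show "(\<Sum>z\<in>{x * b..<x * b + b}. f (z div b) (z mod b)) = (\<Sum>y<b. f x y)"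
      by (simp add: atLeast0LessThan)
  qed
  finally show ?thesis .
qed

lemma entropy_OT:
  shows "(\<Sum>x<nX r. eta (\<Sum>y<nY r. P_OT r x y)) = 2 * r"
    and "(\<Sum>y<nY r. eta (\<Sum>x<nX r. P_OT r x y)) = r + 1"
    and "shannon_mi (nX r) (nY r) (P_OT r) = r"
proof -
  have row: "(\<Sum>y<nY r. P_OT r x y) = 1 / 2^(2*r)" if "x < nX r" for x
    using sum_P_OT_row[of "\<lambda>x. x", OF _ that] by simp
  have "(\<Sum>x<nX r. eta (\<Sum>y<nY r. P_OT r x y)) = (\<Sum>x<nX r. real (2*r) / 2^(2*r))"
    by (intro sum.cong refl) (simp only: lessThan_iff row eta_pow)
  then show 1: "(\<Sum>x<nX r. eta (\<Sum>y<nY r. P_OT r x y)) = 2 * r"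
    by (simp add: nX_def)
  have "(\<Sum>y<nY r. eta (\<Sum>x<nX r. P_OT r x y)) = (\<Sum>y<nY r. real (r+1) / 2^(r+1))"
    by (intro sum.cong refl) (simp only: lessThan_iff sum_P_OT_col eta_pow)
  then show 2: "(\<Sum>y<nY r. eta (\<Sum>x<nX r. P_OT r x y)) = r + 1"
    by (simp add: nY_def)
  have "(\<Sum>x<nX r. \<Sum>y<nY r. eta (P_OT r x y)) = 2 * r + 1"
  proof -
    have "(\<Sum>y<nY r. eta (P_OT r x y)) = 2 * (real (2*r+1) / 2^(2*r+1))" if "x < nX r" for x
      using sum_P_OT_row[of eta, OF _ that] unfolding eta_pow by (simp only: eta_def) simp
    then have "(\<Sum>x<nX r. \<Sum>y<nY r. eta (P_OT r x y)) = (\<Sum>x<nX r. 2 * (real (2*r+1) / 2^(2*r+1)))"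
      by (intro sum.cong refl) (simp only: lessThan_iff)
    then show ?thesis by (simp add: nX_def)
  qed
  then show "shannon_mi (nX r) (nY r) (P_OT r) = r"
    using 1 2 unfolding shannon_mi_def shannon_def
    by (simp add: sum_div_mod[of "\<lambda>x y. eta (P_OT r x y)"])
qed

text \<open>Bob's term of the maximum is bounded. With \<open>H(X) = 2r\<close>,
  \<open>H(Y) = r + 1\<close> and \<open>I(X;Y) = r\<close>, the embedding conditions become the
  hypotheses of \<open>kernel_entropy_gap\<close> for \<open>N = 2^r\<close>; in its conclusion
  \<open>- log 2 N\<close> cancels against \<open>H(X) - I(X;Y) = r\<close>.\<close>

lemma leakage_bound:
  assumes "is_embedding (nX r) (nY r) (P_OT r) d psi"
  shows "leakage (nX r) (nY r) (P_OT r) d psi \<ge> 1 - 1 / (2^r * ln 2)"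
proof -
  let ?X = "{..<nX r}" and ?Y = "{..<nY r}" and ?A = "{..<d 1}" and ?B = "{..<d 3}"
  have d: "d 0 = nX r" "d 2 = nY r" "0 < d 1" "0 < d 3"
    and P: "\<And>x y. x < nX r \<Longrightarrow> y < nY r \<Longrightarrow> (\<Sum>a<d 1. \<Sum>b<d 3. (cmod (psi x a y b))\<^sup>2) = P_OT r x y"
    and q: "qmi psi d {0} {} {2} {3} = r" "qmi psi d {0} {1} {2} {} = r"
    using assms unfolding is_embedding_def entropy_OT by blast+
  interpret bipartite_state ?X ?Y ?A ?B psi "ot_rel r" "2^r"
  proof
    fix x y a b assume *: "x \<in> ?X" "y \<in> ?Y" "\<not> ot_rel r x y" "a \<in> ?A" "b \<in> ?B"
    then have "(\<Sum>a<d 1. \<Sum>b<d 3. (cmod (psi x a y b))\<^sup>2) = 0" using P by (simp add: P_OT_eq)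
    then have "(\<Sum>b<d 3. (cmod (psi x a y b))\<^sup>2) = 0"
      using * by (subst (asm) sum_nonneg_eq_0_iff) (auto intro!: sum_nonneg)
    then show "psi x a y b = 0"
      using * by (subst (asm) sum_nonneg_eq_0_iff) auto
  next
    have "(\<Sum>x<nX r. \<Sum>y<nY r. \<Sum>a<d 1. \<Sum>b<d 3. (cmod (psi x a y b))\<^sup>2) = (\<Sum>x<nX r. \<Sum>y<nY r. P_OT r x y)"
      using P by simp
    also have "\<dots> = (\<Sum>x<nX r. 1 / 2^(2*r))"
      using sum_P_OT_row[of "\<lambda>x. x" _ r] by (intro sum.cong) auto
    finally show "(\<Sum>x<nX r. \<Sum>y<nY r. \<Sum>a<d 1. \<Sum>b<d 3. (cmod (psi x a y b))\<^sup>2) = 1"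
      by (simp add: nX_def)
  qed (use ot_deg_X ot_deg_Y ot_no_4_cycle in auto)
  have dims: "?X = {..<d 0}" "?A = {..<d 1}" "?Y = {..<d 2}" "?B = {..<d 3}"
    "0 < d 0" "0 < d 1" "0 < d 2" "0 < d 3"
    using d by (simp_all add: nX_def nY_def)
  note ents = ent_X[OF dims] ent_Y[OF dims] ent_YB[OF dims] ent_XYB[OF dims] ent_XA[OF dims]
    ent_XYA[OF dims] ent_BB[OF dims] ent_XBB[OF dims]
  have eX: "ent psi d (modes {0} {}) = 2 * r"
    unfolding ents entropy_OT(1)[symmetric] using P by simp
  have eY: "ent psi d (modes {2} {}) = r + 1"
  proof -
    have "(\<Sum>x<nX r. \<Sum>a<d 1. \<Sum>b<d 3. (cmod (psi x a y b))\<^sup>2) = (\<Sum>x<nX r. P_OT r x y)" if "y < nY r" for y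
      using P that by simp
    then show ?thesis unfolding ents entropy_OT(2)[symmetric] by simp
  qed
  have sets: "{0} \<union> {2} = {0, 2::nat}" "{} \<union> {3} = {3::nat}" "{1} \<union> {} = {1::nat}" "{0} \<union> {} = {0::nat}"
    "{} \<union> {2, 3} = {2, 3::nat}"
    by auto
  have "(\<Sum>x\<in>?X. \<Sum>y\<in>?Y. kernel_entropy ?B (G x y)) = (\<Sum>y\<in>?Y. kernel_entropy ?B (GY y)) + log 2 (real (2^r))"
    using q(1) eX unfolding qmi_def sets ents by simp
  moreover have "(\<Sum>x\<in>?X. \<Sum>y\<in>?Y. kernel_entropy ?A (T x y)) = (\<Sum>x\<in>?X. kernel_entropy ?A (TX x)) + 1"
    using q(2) eY unfolding qmi_def sets ents by simp
  ultimately have "kernel_entropy (?Y \<times> ?B) R - (\<Sum>x\<in>?X. kernel_entropy (?Y \<times> ?B) (RX x)) \<ge> 1 - log 2 (real (2^r)) - 1 / (real (2^r) * ln 2)"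
    by (rule kernel_entropy_gap)
  then have "qmi psi d {0} {} {} {2, 3} - r \<ge> 1 - 1 / (2^r * ln 2)"
    using eX unfolding qmi_def sets ents by simp
  then show ?thesis unfolding leakage_def entropy_OT by simp
qed

theorem theorem8:
  shows "\<exists>C::real. \<forall>r::nat. r \<ge> 1 \<longrightarrow>
           (\<forall>d psi. is_embedding (nX r) (nY r) (P_OT r) d psi \<longrightarrow>
              leakage (nX r) (nY r) (P_OT r) d psi \<ge> 1 - C * real r / 2 ^ r)"
proof (intro exI[of _ "1 / ln 2"] allI impI)
  fix r :: nat and d psi
  assume r: "1 \<le> r" and emb: "is_embedding (nX r) (nY r) (P_OT r) d psi"
  \<comment> \<open>The factor \<open>r \<ge> 1\<close> only weakens the bound already obtained, so
    \<open>C = 1 / ln 2\<close> works.\<close>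
  have "1 / (2^r * ln 2) \<le> 1 / ln 2 * real r / 2^r"
    using r by (simp add: field_simps)
  then show "1 - 1 / ln 2 * real r / 2^r \<le> leakage (nX r) (nY r) (P_OT r) d psi"
    using leakage_bound[OF emb] by linarith
qed

end
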